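(* The following inequality holds for all $m\geq2$: \[\mathrm{Tv}(\mathbb{Z}^3, m) \leq 24m- 31.\]
   Context: For $S\subseteq\mathbb{R}^d$ and an integer $m\geq 2$, the Tverberg number $\mathrm{Tv}(S,m)$ is the smallest positive integer $n$ such that any multiset of $n$ points in $S$ admits a partition into $m$ submultisets $A_1,\dots,A_m$ with $\left(\bigcap_{i=1}^m\mathrm{conv}(A_i)\right)\cap S\neq\varnothing$ (and $\mathrm{Tv}(S,m)=\infty$ if no such number exists). *)

theory Defs
  imports "HOL-Analysis.Analysis" "HOL-Library.Multiset" "HOL-Library.Extended_Nat"
begin

definition tverberg_partitionable :: "'a::euclidean_space set \<Rightarrow> nat \<Rightarrow> 'a multiset \<Rightarrow> bool" where
  "tverberg_partitionable S m X \<longleftrightarrow>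
     (\<exists>A :: nat \<Rightarrow> 'a multiset. (\<Sum>i<m. A i) = X \<and>
        (\<Inter>i<m. convex hull (set_mset (A i))) \<inter> S \<noteq> {})"

definition tverberg_property :: "'a::euclidean_space set \<Rightarrow> nat \<Rightarrow> nat \<Rightarrow> bool" where
  "tverberg_property S m n \<longleftrightarrow>
     (\<forall>X :: 'a multiset. set_mset X \<subseteq> S \<and> size X = n \<longrightarrow> tverberg_partitionable S m X)"

definition Tv :: "'a::euclidean_space set \<Rightarrow> nat \<Rightarrow> enat" where
  "Tv S m = (if \<exists>n>0. tverberg_property S m n
             then enat (LEAST n. n > 0 \<and> tverberg_property S m n) else \<infinity>)"

definition int_lattice3 :: "(real^3) set" where
  "int_lattice3 = {x. \<forall>i. x $ i \<in> \<int>}"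

end

theory Submission
  imports Defs
begin

text \<open>
  Doignon's theorem (Helly number 8 for the integer lattice of dimension 3) gives, for 24m - 31 lattice
  points, a lattice point c that stays in the convex hull after any 3m - 4 of the points are
  deleted. Splitting off a minimal simplex around c costs at most 3 of this depth, so after m - 2
  such steps c still has depth 3. It remains to split a family of depth 3 in 3-space into two
  parts that both surround c.

  Suppose that this is impossible, and take c as the origin. Then no three points of the family surround it. Slide one point
  x in the direction of another point t until, for the first time, some triple x, y, z surrounds
  the origin. Up to that moment the sets that surround the origin do not change. At
  that moment the plane of the triple has exactly three further points on one side, and at least two
  points on the other side, all of them in the cone opposite to those three. The
  coordinates of x, y, z with respect to the three points then have a rigid sign pattern, which forces
  two disjoint quadruples that surround the origin shortly before the collision.
\<close>

subsection \<open>Finite families surrounding the origin\<close>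

text \<open>The constant is 24m - 31 = 8(3m - 4) + 1. Removing a minimal simplex turns
  \<open>deep k\<close> into \<open>deep (k - 3)\<close>, so removals alone would need depth 3(m -
  1) + 1 for m parts, that is 8(3m - 3) + 1 = 24m - 23 lattice points. The gain of 8 comes entirely
  from the last split, which gets by with depth 3; a removal there would leave depth 0, which says
  nothing about the remainder. The absence of surrounding triples takes over that role: then every
  surrounding quadruple is a nondegenerate simplex around the origin and survives small motions. The
  collision is the first moment at which this fails. Families are indexed, so that repeated points
  of a multiset keep their identity.\<close>

definition surrounds :: "('i \<Rightarrow> 'a::euclidean_space) \<Rightarrow> 'i set \<Rightarrow> bool" where
  "surrounds v J \<longleftrightarrow> 0 \<in> convex hull (v ` J)"

lemma surrounds_mono: "surrounds v J \<Longrightarrow> J \<subseteq> K \<Longrightarrow> surrounds v K"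
  unfolding surrounds_def by (meson hull_mono image_mono subsetD)

lemma surrounds_cong: "(\<And>i. i \<in> J \<Longrightarrow> v i = w i) \<Longrightarrow> surrounds v J = surrounds w J"
  unfolding surrounds_def by (metis image_cong)

lemma not_surrounds_empty [simp]: "\<not> surrounds v {}"
  unfolding surrounds_def by simp

lemma surrounds_if_cone:
  assumes "finite J" "\<And>i. i \<in> J \<Longrightarrow> 0 \<le> c i" "k \<in> J" "0 < c k" "(\<Sum>i\<in>J. c i *\<^sub>R v i) = 0"
  shows "surrounds v J"
proof -
  define s where "s = sum c J"
  have s: "s > 0"
    unfolding s_def using assms by (intro sum_pos2[of _ k]) auto
  have "(\<Sum>i\<in>J. (c i / s) *\<^sub>R v i) \<in> convex hull (v ` J)"
    by (rule convex_sum) (use assms s in \<open>auto simp: hull_inc sum_divide_distrib[symmetric] s_def\<close>)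
  moreover have "(\<Sum>i\<in>J. (c i / s) *\<^sub>R v i) = (1 / s) *\<^sub>R (\<Sum>i\<in>J. c i *\<^sub>R v i)"
    by (simp add: scaleR_right.sum)
  ultimately show ?thesis
    using assms(5) by (simp add: surrounds_def)
qed

lemma surroundsE:
  assumes "surrounds v J" "finite J"
  obtains c where "\<And>i. i \<in> J \<Longrightarrow> 0 \<le> c i" "sum c J = (1::real)" "(\<Sum>i\<in>J. c i *\<^sub>R v i) = 0"
proof -
  \<comment> \<open>\<open>v\<close> need not be injective: \<open>U\<close> keeps one index for
    each point, and all other indices receive weight 0.\<close>
  obtain U where U: "U \<subseteq> J" "inj_on v U" "v ` J = v ` U"
    using subset_image_inj[of "v ` J" v J] by blast
  have fU: "finite U" using U assms finite_subset by auto
  obtain d where d: "\<forall>x\<in>v ` U. 0 \<le> d x" "sum d (v ` U) = (1::real)" "(\<Sum>x\<in>v ` U. d x *\<^sub>R x) = 0"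
    using assms(1) fU unfolding surrounds_def U(3) convex_hull_finite[OF finite_imageI[OF fU]] by auto
  define c where "c i = (if i \<in> U then d (v i) else 0)" for i
  have "sum c J = sum c U"
    by (rule sum.mono_neutral_right) (use U assms in \<open>auto simp: c_def\<close>)
  also have "\<dots> = sum d (v ` U)"
    by (simp add: sum.reindex[OF U(2)] c_def)
  finally have 1: "sum c J = 1" using d by simp
  have "(\<Sum>i\<in>J. c i *\<^sub>R v i) = (\<Sum>i\<in>U. c i *\<^sub>R v i)"
    by (rule sum.mono_neutral_right) (use U assms in \<open>auto simp: c_def\<close>)
  also have "\<dots> = (\<Sum>x\<in>v ` U. d x *\<^sub>R x)"
    by (simp add: sum.reindex[OF U(2)] c_def)
  finally have 2: "(\<Sum>i\<in>J. c i *\<^sub>R v i) = 0" using d by simp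
  show ?thesis
    by (rule that[of c]) (use d 1 2 U in \<open>auto simp: c_def\<close>)
qed

lemma not_surroundsE:
  assumes "\<not> surrounds v J" "finite J"
  obtains u where "\<And>i. i \<in> J \<Longrightarrow> u \<bullet> v i > 0"
proof -
  have "\<exists>a b. a \<noteq> 0 \<and> 0 < b \<and> (\<forall>x\<in>convex hull (v ` J). inner a x > b)"
    by (rule separating_hyperplane_closed_0)
      (use assms in \<open>auto simp: surrounds_def compact_imp_closed finite_imp_compact compact_convex_hull\<close>)
  then obtain a b where "0 < b" "\<forall>x\<in>convex hull (v ` J). inner a x > b"
    by blast
  then have "a \<bullet> v i > 0" if "i \<in> J" for i
    using hull_inc[of "v i" "v ` J" convex] that by fastforce
  then show ?thesis using that by blast
qed

lemma surrounds_inner: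
  assumes "surrounds v J" "finite J"
  obtains i where "i \<in> J" "u \<bullet> v i \<le> 0"
proof -
  obtain c where c: "\<And>i. i \<in> J \<Longrightarrow> 0 \<le> c i" "sum c J = (1::real)" "(\<Sum>i\<in>J. c i *\<^sub>R v i) = 0"
    using surroundsE assms by blast
  have "\<exists>i\<in>J. u \<bullet> v i \<le> 0"
  proof (rule ccontr)
    assume *: "\<not> (\<exists>i\<in>J. u \<bullet> v i \<le> 0)"
    have "(\<Sum>i\<in>J. c i * (u \<bullet> v i)) = u \<bullet> (\<Sum>i\<in>J. c i *\<^sub>R v i)"
      by (simp add: inner_sum_right)
    then have "(\<Sum>i\<in>J. c i * (u \<bullet> v i)) = 0" using c by simp
    moreover have "\<And>i. i \<in> J \<Longrightarrow> 0 \<le> c i * (u \<bullet> v i)"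
      using c * by (auto simp: not_le less_imp_le)
    ultimately have "\<forall>i\<in>J. c i * (u \<bullet> v i) = 0"
      using sum_nonneg_eq_0_iff[OF assms(2), of "\<lambda>i. c i * (u \<bullet> v i)"] by blast
    then have "\<forall>i\<in>J. c i = 0" using * by (metis mult_eq_0_iff order_refl)
    then show False using c by simp
  qed
  then show ?thesis using that by blast
qed

text \<open>The inner product of \<open>u\<close> with a convex relation is a vanishing sum of
  nonnegative terms, so all weight sits on the hyperplane orthogonal to \<open>u\<close>.\<close>

lemma surrounds_face:
  assumes "surrounds v J" "finite J" "\<And>i. i \<in> J \<Longrightarrow> u \<bullet> v i \<ge> 0"
  shows "surrounds v {i \<in> J. u \<bullet> v i = 0}"
proof -
  obtain c where c: "\<And>i. i \<in> J \<Longrightarrow> 0 \<le> c i" "sum c J = (1::real)" "(\<Sum>i\<in>J. c i *\<^sub>R v i) = 0"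
    using surroundsE assms by blast
  have "(\<Sum>i\<in>J. c i * (u \<bullet> v i)) = u \<bullet> (\<Sum>i\<in>J. c i *\<^sub>R v i)"
    by (simp add: inner_sum_right)
  then have "(\<Sum>i\<in>J. c i * (u \<bullet> v i)) = 0" using c by simp
  moreover have "\<And>i. i \<in> J \<Longrightarrow> 0 \<le> c i * (u \<bullet> v i)"
    using c assms by auto
  ultimately have z: "\<forall>i\<in>J. c i * (u \<bullet> v i) = 0"
    using sum_nonneg_eq_0_iff[OF assms(2), of "\<lambda>i. c i * (u \<bullet> v i)"] by blast
  have "sum c {i \<in> J. u \<bullet> v i = 0} = sum c J"
    by (rule sum.mono_neutral_left) (use assms z in auto)
  then have s: "sum c {i \<in> J. u \<bullet> v i = 0} > 0" using c by simp
  then obtain k where "k \<in> {i \<in> J. u \<bullet> v i = 0}" "c k > 0"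
    using sum_nonpos[of "{i \<in> J. u \<bullet> v i = 0}" c] by (meson not_le)
  moreover have "(\<Sum>i\<in>{i \<in> J. u \<bullet> v i = 0}. c i *\<^sub>R v i) = (\<Sum>i\<in>J. c i *\<^sub>R v i)"
    by (rule sum.mono_neutral_left) (use assms z in auto)
  ultimately show ?thesis
    by (intro surrounds_if_cone[of _ c k]) (use assms c in auto)
qed

lemma surrounds_caratheodory:
  fixes v :: "'i \<Rightarrow> 'a::euclidean_space"
  assumes "surrounds v J"
  obtains K where "K \<subseteq> J" "finite K" "card K \<le> DIM('a) + 1" "surrounds v K"
proof -
  from assms obtain S where S: "finite S" "S \<subseteq> v ` J" "card S \<le> DIM('a) + 1" "0 \<in> convex hull S"
    using caratheodory[of "v ` J"] unfolding surrounds_def by auto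
  then obtain U where U: "U \<subseteq> J" "inj_on v U" "S = v ` U"
    using subset_image_inj[of S v J] by blast
  show ?thesis
    using that[of U] U S by (auto simp: surrounds_def card_image finite_image_iff)
qed

text \<open>Caratheodory's bound depends on the affine dimension, which drops by one in a
  hyperplane.\<close>

lemma surrounds_caratheodory_plane:
  fixes v :: "'i \<Rightarrow> 'a::euclidean_space"
  assumes "surrounds v J" "u \<noteq> 0" "\<And>i. i \<in> J \<Longrightarrow> u \<bullet> v i = 0"
  obtains K where "K \<subseteq> J" "finite K" "card K \<le> DIM('a)" "surrounds v K"
proof -
  have "v ` J \<subseteq> {x. u \<bullet> x = 0}" using assms by auto
  then have d: "aff_dim (v ` J) \<le> DIM('a) - 1"
    using aff_dim_subset aff_dim_hyperplane[OF assms(2), of 0] by metis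
  from assms(1) obtain S where S: "finite S" "S \<subseteq> v ` J" "card S \<le> aff_dim (v ` J) + 1" "0 \<in> convex hull S"
    using caratheodory_aff_dim[of "v ` J"] unfolding surrounds_def by auto
  then obtain U where U: "U \<subseteq> J" "inj_on v U" "S = v ` U"
    using subset_image_inj[of S v J] by blast
  have "card U \<le> DIM('a)"
    using S(3) d DIM_positive[where 'a='a] card_image[OF U(2)] unfolding U(3) by linarith
  then show ?thesis
    using that[of U] U S by (auto simp: surrounds_def card_image finite_image_iff)
qed

text \<open>This is Tukey depth at least \<open>k\<close>: for finite \<open>I\<close>, separation
  shows that each closed half-space \<open>u \<bullet> x \<le> 0\<close> contains at least
  \<open>k\<close> indices of the family. Because of the strict bound, \<open>deep 0\<close> is
  vacuous.\<close>

definition deep :: "nat \<Rightarrow> 'i set \<Rightarrow> ('i \<Rightarrow> 'a::euclidean_space) \<Rightarrow> bool" where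
  "deep k I v \<longleftrightarrow> (\<forall>J\<subseteq>I. card J < k \<longrightarrow> surrounds v (I - J))"

lemma deepD: "deep k I v \<Longrightarrow> card J < k \<Longrightarrow> J \<subseteq> I \<Longrightarrow> surrounds v (I - J)"
  by (simp add: deep_def)

lemma surrounds_singleton: "surrounds v {j} \<longleftrightarrow> v j = 0"
  by (auto simp: surrounds_def)

text \<open>Suppose that \<open>u\<close> is positive on \<open>I - J\<close>. Deleting all of
  \<open>J\<close> except \<open>j\<close>, hence at most two indices, shows that \<open>u\<close>
  is nonpositive at each \<open>j\<close>. As \<open>J\<close> surrounds the origin, some
  \<open>j\<close> lies on the hyperplane; then the zero face of \<open>I - (J - {j})\<close> is
  \<open>j\<close> alone, so \<open>v j = 0\<close>.\<close>

lemma deep_split_small: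
  fixes v :: "'i \<Rightarrow> real^3"
  assumes "finite I" "deep 3 I v" "J \<subseteq> I" "card J \<le> 3" "surrounds v J" "\<And>j. j \<in> J \<Longrightarrow> v j \<noteq> 0"
  shows "surrounds v (I - J)"
proof (rule ccontr)
  assume "\<not> ?thesis"
  then obtain u where u: "\<And>i. i \<in> I - J \<Longrightarrow> u \<bullet> v i > 0"
    by (rule not_surroundsE) (use assms in auto)
  have fJ: "finite J" using assms finite_subset by blast
  have surr: "surrounds v (I - (J - {j}))" if "j \<in> J" for j
    by (rule deepD[OF assms(2)]) (use that assms fJ card_Diff1_less[of J j] in auto)
  have nonpos: "u \<bullet> v j \<le> 0" if "j \<in> J" for j
  proof (rule ccontr)
    assume "\<not> u \<bullet> v j \<le> 0"
    then have "u \<bullet> v i > 0" if "i \<in> I - (J - {j})" for i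
      using u that \<open>j \<in> J\<close> by (cases "i = j") auto
    then show False
      using surrounds_inner[OF surr[OF that], of u] assms(1) by (metis finite_Diff not_le)
  qed
  have "surrounds v {j \<in> J. (- u) \<bullet> v j = 0}"
    using assms(5) fJ by (rule surrounds_face) (use nonpos in auto)
  then obtain j where j: "j \<in> J" "u \<bullet> v j = 0"
    by (metis (mono_tags, lifting) Collect_empty_eq inner_minus_left neg_equal_0_iff_equal not_surrounds_empty)
  have "surrounds v {i \<in> I - (J - {j}). u \<bullet> v i = 0}"
  proof (rule surrounds_face[OF surr[OF j(1)]])
    show "u \<bullet> v i \<ge> 0" if "i \<in> I - (J - {j})" for i
      using u[of i] j that by (cases "i = j") auto
  qed (use assms in auto)
  moreover have "{i \<in> I - (J - {j}). u \<bullet> v i = 0} = {j}"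
    using u j assms(3) by force
  ultimately show False
    using assms(6) j by (simp add: surrounds_singleton)
qed

subsection \<open>Lattice centre points\<close>

text \<open>
  The thresholds are lowered one constraint at a time. A witness of tightness survives the later
  steps, since these only enlarge the other half-spaces.
\<close>

lemma tighten_constraints:
  fixes f :: "'g \<Rightarrow> 'a \<Rightarrow> real"
  assumes "finite W" "finite G"
    and infeas: "\<not> (\<exists>w\<in>W. \<forall>g\<in>G. f g w > \<beta> g)"
    and minimal: "\<And>h. h \<in> G \<Longrightarrow> \<exists>w\<in>W. \<forall>g\<in>G-{h}. f g w > \<beta> g"
    and "K \<subseteq> G"
  shows "\<exists>\<gamma>. \<not> (\<exists>w\<in>W. \<forall>g\<in>G. f g w > \<gamma> g) \<and> (\<forall>g\<in>G. \<gamma> g \<le> \<beta> g) \<and>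
    (\<forall>h\<in>K. \<exists>w\<in>W. f h w = \<gamma> h \<and> (\<forall>g\<in>G-{h}. f g w > \<gamma> g))"
proof -
  have "finite K" using assms finite_subset by blast
  then show ?thesis using \<open>K \<subseteq> G\<close>
  proof (induction K rule: finite_induct)
    case empty
    show ?case using infeas by (intro exI[of _ \<beta>]) auto
  next
    case (insert k K)
    then obtain \<gamma> where g: "\<not> (\<exists>w\<in>W. \<forall>g\<in>G. f g w > \<gamma> g)" "\<forall>g\<in>G. \<gamma> g \<le> \<beta> g"
      "\<forall>h\<in>K. \<exists>w\<in>W. f h w = \<gamma> h \<and> (\<forall>g\<in>G-{h}. f g w > \<gamma> g)" by auto
    have k: "k \<in> G" using insert by simp
    \<comment> \<open>\<open>R\<close> collects the witnesses for all constraints except possibly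
      \<open>k\<close>; it is nonempty because \<open>\<gamma> \<le> \<beta>\<close>. The maximum of
      \<open>f k\<close> on \<open>R\<close> is the new threshold: nothing in \<open>R\<close>
      exceeds it, and some element attains it.\<close>
    define R where "R = {w \<in> W. \<forall>g\<in>G-{k}. f g w > \<gamma> g}"
    have R: "finite R" "R \<noteq> {}"
      using \<open>finite W\<close> minimal[OF k] g(2) by (force simp: R_def)+
    then obtain z where z: "z \<in> R" "\<And>w. w \<in> R \<Longrightarrow> f k w \<le> f k z"
      using Max_in[of "f k ` R"] Max_ge[of "f k ` R"] by fastforce
    have zk: "f k z \<le> \<gamma> k"
      using z(1) g(1) by (force simp: R_def not_less)
    define \<gamma>' where "\<gamma>' = \<gamma>(k := f k z)"
    have le: "\<gamma>' g \<le> \<gamma> g" for g using zk by (simp add: \<gamma>'_def)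
    have "\<not> (\<exists>w\<in>W. \<forall>g\<in>G. f g w > \<gamma>' g)"
    proof
      assume "\<exists>w\<in>W. \<forall>g\<in>G. f g w > \<gamma>' g"
      then obtain w where w: "w \<in> W" "\<forall>g\<in>G. f g w > \<gamma>' g" by blast
      have "f g w > \<gamma> g" if "g \<in> G - {k}" for g
        using bspec[OF w(2), of g] that by (simp add: \<gamma>'_def)
      then have "w \<in> R" using w(1) by (simp add: R_def)
      then show False using z(2)[of w] w(2) k by (auto simp: \<gamma>'_def)
    qed
    moreover have "\<forall>g\<in>G. \<gamma>' g \<le> \<beta> g" using le g(2) order_trans by blast
    moreover have "\<exists>w\<in>W. f h w = \<gamma>' h \<and> (\<forall>g\<in>G-{h}. f g w > \<gamma>' g)" if "h \<in> insert k K" for h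
    proof (cases "h = k")
      case True
      then show ?thesis using z(1) by (auto simp: R_def \<gamma>'_def)
    next
      case False
      then have "h \<in> K" using that by simp
      then obtain w where w: "w \<in> W" "f h w = \<gamma> h" "\<forall>g\<in>G-{h}. f g w > \<gamma> g" using g(3) by blast
      then have "\<forall>g\<in>G-{h}. f g w > \<gamma>' g" using le le_less_trans by blast
      then show ?thesis using w(1,2) False by (intro bexI[of _ w]) (simp_all add: \<gamma>'_def)
    qed
    ultimately show ?case by blast
  qed
qed

lemma same_parity_midpoint:
  fixes x y :: "real^3"
  assumes "x \<in> int_lattice3" "y \<in> int_lattice3" "\<And>i. even \<lfloor>x $ i\<rfloor> = even \<lfloor>y $ i\<rfloor>"
  shows "(1/2) *\<^sub>R (x + y) \<in> int_lattice3"
proof -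
  have "((1/2) *\<^sub>R (x + y)) $ i \<in> \<int>" for i
  proof -
    obtain a b where ab: "x $ i = of_int a" "y $ i = of_int b"
      using assms(1,2) unfolding int_lattice3_def mem_Collect_eq by (meson Ints_cases)
    then have "even (a + b)" using assms(3)[of i] by auto
    then obtain c where "a + b = 2 * c" by blast
    then have "((1/2) *\<^sub>R (x + y)) $ i = of_int c"
      using ab by (simp flip: of_int_add)
    then show ?thesis by (metis Ints_of_int)
  qed
  then show ?thesis by (simp add: int_lattice3_def)
qed

text \<open>Among nine critical constraints, two tight witnesses share one of the 2^3 = 8 parity
  classes. A finite \<open>W\<close> closed under lattice midpoints stands in for the lattice, so
  that the tightened thresholds are attained maxima.\<close>

lemma doignon_halfspaces:
  fixes W :: "(real^3) set" and u :: "'g \<Rightarrow> real^3" and \<beta> :: "'g \<Rightarrow> real"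
  assumes W: "finite W" "W \<subseteq> int_lattice3"
    and mid: "\<And>x y. x \<in> W \<Longrightarrow> y \<in> W \<Longrightarrow> (1/2) *\<^sub>R (x + y) \<in> int_lattice3 \<Longrightarrow> (1/2) *\<^sub>R (x + y) \<in> W"
    and "finite G"
    and small: "\<And>K. K \<subseteq> G \<Longrightarrow> card K \<le> 8 \<Longrightarrow> \<exists>w\<in>W. \<forall>g\<in>K. u g \<bullet> w > \<beta> g"
  shows "\<exists>w\<in>W. \<forall>g\<in>G. u g \<bullet> w > \<beta> g"
  using \<open>finite G\<close> small
proof (induction G rule: finite_psubset_induct)
  case (psubset G)
  show ?case
  proof (rule ccontr)
    assume inf: "\<not> ?case"
    then have c8: "card G > 8"
      using psubset.prems[of G] by (meson not_le order_refl)
    have critical: "\<exists>w\<in>W. \<forall>g\<in>G-{h}. u g \<bullet> w > \<beta> g" if "h \<in> G" for h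
    proof (rule psubset.IH)
      show "G - {h} \<subset> G" using that by blast
      show "\<exists>w\<in>W. \<forall>g\<in>K. u g \<bullet> w > \<beta> g" if "K \<subseteq> G - {h}" "card K \<le> 8" for K
        using psubset.prems[of K] that by blast
    qed
    have "\<exists>\<gamma>. \<not> (\<exists>w\<in>W. \<forall>g\<in>G. u g \<bullet> w > \<gamma> g) \<and> (\<forall>g\<in>G. \<gamma> g \<le> \<beta> g) \<and>
      (\<forall>h\<in>G. \<exists>w\<in>W. u h \<bullet> w = \<gamma> h \<and> (\<forall>g\<in>G-{h}. u g \<bullet> w > \<gamma> g))"
      by (rule tighten_constraints[OF W(1) psubset.hyps(1) inf critical order_refl])
    then obtain \<gamma> where g: "\<not> (\<exists>w\<in>W. \<forall>g\<in>G. u g \<bullet> w > \<gamma> g)"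
      "\<forall>h\<in>G. \<exists>w\<in>W. u h \<bullet> w = \<gamma> h \<and> (\<forall>g\<in>G-{h}. u g \<bullet> w > \<gamma> g)"
      by (elim exE conjE) (rule that)
    have "\<forall>h\<in>G. \<exists>w. w \<in> W \<and> u h \<bullet> w = \<gamma> h \<and> (\<forall>g\<in>G-{h}. u g \<bullet> w > \<gamma> g)"
      using g(2) by blast
    from bchoice[OF this] obtain w where
      "\<forall>h\<in>G. w h \<in> W \<and> u h \<bullet> w h = \<gamma> h \<and> (\<forall>g\<in>G-{h}. u g \<bullet> w h > \<gamma> g)" ..
    then have w: "\<And>h. h \<in> G \<Longrightarrow> w h \<in> W" "\<And>h. h \<in> G \<Longrightarrow> u h \<bullet> w h = \<gamma> h"
      "\<And>h g. h \<in> G \<Longrightarrow> g \<in> G \<Longrightarrow> g \<noteq> h \<Longrightarrow> u g \<bullet> w h > \<gamma> g"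
      by auto
    \<comment> \<open>Two witnesses of the same parity have a lattice midpoint, which satisfies all the tightened
      constraints strictly: each of the two witnesses is tight for its own constraint only.\<close>
    define par :: "'g \<Rightarrow> bool^3" where "par h = (\<chi> i. even \<lfloor>w h $ i\<rfloor>)" for h
    have "card (par ` G) \<le> CARD(bool^3)"
      by (rule card_mono) auto
    then have "\<not> inj_on par G"
      using c8 by (intro pigeonhole) simp
    then obtain h k where hk: "h \<in> G" "k \<in> G" "h \<noteq> k" "par h = par k"
      by (auto simp: inj_on_def)
    define m where "m = (1/2) *\<^sub>R (w h + w k)"
    have "even \<lfloor>w h $ i\<rfloor> = even \<lfloor>w k $ i\<rfloor>" for i
      using hk(4) by (simp add: par_def vec_eq_iff)
    then have "m \<in> W"
      unfolding m_def using w(1) hk W(2) by (intro mid same_parity_midpoint) auto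
    moreover have "u g \<bullet> m > \<gamma> g" if "g \<in> G" for g
    proof -
      have "u g \<bullet> m = (u g \<bullet> w h + u g \<bullet> w k) / 2"
        by (simp add: m_def inner_add_right)
      moreover have "u g \<bullet> w h \<ge> \<gamma> g" "u g \<bullet> w k \<ge> \<gamma> g" "u g \<bullet> w h > \<gamma> g \<or> u g \<bullet> w k > \<gamma> g"
        using w(2,3)[of g] w(3)[of h g] w(3)[of k g] hk that by (cases "g = h"; cases "g = k"; force)+
      ultimately show ?thesis by argo
    qed
    ultimately show False using g(1) by blast
  qed
qed

lemma finite_lattice_box: "finite {x \<in> int_lattice3. \<forall>i. \<bar>x $ i\<bar> \<le> b}"
proof -
  let ?Z = "real_of_int ` {-\<lceil>b\<rceil>..\<lceil>b\<rceil>}"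
  have "{x \<in> int_lattice3. \<forall>i. \<bar>x $ i\<bar> \<le> b} \<subseteq> vec_lambda ` (PiE UNIV (\<lambda>_. ?Z))"
  proof
    fix x :: "real^3" assume "x \<in> {x \<in> int_lattice3. \<forall>i. \<bar>x $ i\<bar> \<le> b}"
    then have x: "x $ i \<in> \<int>" "\<bar>x $ i\<bar> \<le> b" for i by (auto simp: int_lattice3_def)
    have "x $ i \<in> ?Z" for i
    proof -
      obtain k where k: "x $ i = of_int k" using x(1) Ints_cases by blast
      then have "k \<in> {-\<lceil>b\<rceil>..\<lceil>b\<rceil>}" using x(2)[of i] by (simp add: abs_le_iff) linarith
      then show ?thesis using k by blast
    qed
    then show "x \<in> vec_lambda ` (PiE UNIV (\<lambda>_. ?Z))"
      by (intro image_eqI[of _ _ "vec_nth x"]) auto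
  qed
  moreover have "finite (vec_lambda ` (PiE UNIV (\<lambda>_::3. ?Z)) :: (real^3) set)"
    by (intro finite_imageI finite_PiE) auto
  ultimately show ?thesis by (rule finite_subset)
qed

text \<open>Call a half-space heavy if it misses at most \<open>k\<close> of the points. Eight heavy
  half-spaces together miss at most 8k points, so some point of the family lies in all of them;
  Doignon's theorem then gives a lattice point common to all heavy half-spaces.\<close>

lemma lattice_centerpoint:
  fixes p :: "'i \<Rightarrow> real^3"
  assumes "finite I" "p ` I \<subseteq> int_lattice3" "card I > 8 * k"
  obtains c where "c \<in> int_lattice3" "\<And>J. J \<subseteq> I \<Longrightarrow> card J \<le> k \<Longrightarrow> surrounds (\<lambda>i. p i - c) (I - J)"
proof -
  define heavy where "heavy g \<longleftrightarrow> card {i \<in> I. \<not> fst g \<bullet> p i > snd g} \<le> k" for g :: "(real^3) \<times> real"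
  obtain b where b: "\<And>i j. i \<in> I \<Longrightarrow> \<bar>p i $ j\<bar> \<le> b"
  proof
    fix i j assume "i \<in> I"
    then have "norm (p i) \<le> (\<Sum>i\<in>I. norm (p i))"
      using \<open>finite I\<close> by (intro member_le_sum) auto
    then show "\<bar>p i $ j\<bar> \<le> (\<Sum>i\<in>I. norm (p i))"
      using component_le_norm_cart[of "p i" j] by linarith
  qed
  \<comment> \<open>A box around the points is closed under lattice midpoints and contains only
    finitely many lattice points.\<close>
  define W where "W = {x \<in> int_lattice3. \<forall>i. \<bar>x $ i\<bar> \<le> b}"
  have mid: "(1/2) *\<^sub>R (x + y) \<in> W" if "x \<in> W" "y \<in> W" "(1/2) *\<^sub>R (x + y) \<in> int_lattice3" for x y
  proof -
    have "\<bar>((1/2) *\<^sub>R (x + y)) $ i\<bar> \<le> b" for i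
    proof -
      have "\<bar>x $ i\<bar> \<le> b" "\<bar>y $ i\<bar> \<le> b" using that by (auto simp: W_def)
      then show ?thesis by (simp add: abs_le_iff)
    qed
    then show ?thesis using that(3) by (simp add: W_def)
  qed
  have pW: "p i \<in> W" if "i \<in> I" for i using b assms(2) that by (auto simp: W_def)
  have small: "\<exists>w\<in>W. \<forall>g\<in>K. fst g \<bullet> w > snd g" if K: "finite K" "card K \<le> 8" "\<And>g. g \<in> K \<Longrightarrow> heavy g" for K
  proof -
    let ?B = "\<lambda>g. {i \<in> I. \<not> fst g \<bullet> p i > snd g}"
    have "card (\<Union>g\<in>K. ?B g) \<le> (\<Sum>g\<in>K. card (?B g))" using K(1) by (rule card_UN_le)
    also have "\<dots> \<le> card K * k" using sum_bounded_above[of K "\<lambda>g. card (?B g)" k] K(3) by (auto simp: heavy_def)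
    also have "\<dots> \<le> 8 * k" using K(2) by simp
    finally have "card (\<Union>g\<in>K. ?B g) < card I" using assms(3) by simp
    then have "\<not> I \<subseteq> (\<Union>g\<in>K. ?B g)"
      using card_mono[of "\<Union>g\<in>K. ?B g" I] K(1) \<open>finite I\<close> by fastforce
    then show ?thesis using pW by blast
  qed
  have "\<exists>w\<in>W. \<forall>g. heavy g \<longrightarrow> fst g \<bullet> w > snd g"
  proof (rule ccontr)
    assume "\<not> ?thesis"
    \<comment> \<open>There are infinitely many heavy half-spaces, but one violated half-space for
      each candidate in the finite set \<open>W\<close> gives a finite system.\<close>
    then obtain G where G: "\<And>w. w \<in> W \<Longrightarrow> heavy (G w) \<and> \<not> fst (G w) \<bullet> w > snd (G w)" by metis
    have fin: "finite W" unfolding W_def by (rule finite_lattice_box)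
    have "\<exists>w\<in>W. \<forall>g\<in>G ` W. fst g \<bullet> w > snd g"
    proof (rule doignon_halfspaces)
      show "\<exists>w\<in>W. \<forall>g\<in>K. fst g \<bullet> w > snd g" if "K \<subseteq> G ` W" "card K \<le> 8" for K
        by (rule small) (use that G fin finite_subset in blast)+
    qed (use fin mid in \<open>auto simp: W_def\<close>)
    then show False using G by blast
  qed
  then obtain c where c: "c \<in> W" "\<And>g. heavy g \<Longrightarrow> fst g \<bullet> c > snd g" by blast
  have "surrounds (\<lambda>i. p i - c) (I - J)" if J: "J \<subseteq> I" "card J \<le> k" for J
  proof (rule ccontr)
    assume "\<not> ?thesis"
    then obtain u where u: "\<And>i. i \<in> I - J \<Longrightarrow> u \<bullet> (p i - c) > 0"
      by (rule not_surroundsE) (use \<open>finite I\<close> in auto)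
    \<comment> \<open>The open half-space bounded by the plane through \<open>c\<close> misses only
      points of \<open>J\<close>, so it is heavy and would have to contain \<open>c\<close>.\<close>
    have "{i \<in> I. \<not> u \<bullet> p i > u \<bullet> c} \<subseteq> J" using u by (force simp: inner_diff_right)
    then have "heavy (u, u \<bullet> c)"
      unfolding heavy_def fst_conv snd_conv
      using card_mono[OF finite_subset[OF J(1) \<open>finite I\<close>]] J(2) order_trans by blast
    from c(2)[OF this] show False by simp
  qed
  then show ?thesis using that[of c] c(1) by (auto simp: W_def)
qed

subsection \<open>Sign patterns at a collision\<close>

text \<open>Fixing the coefficient of \<open>a\<close> at 1 keeps the relation nontrivial, so that
  it can be rescaled to a convex one.\<close>

definition cone_zero :: "'a::real_vector \<Rightarrow> 'a \<Rightarrow> 'a \<Rightarrow> 'a \<Rightarrow> bool" where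
  "cone_zero a b c d \<longleftrightarrow> (\<exists>p q r. p \<ge> 0 \<and> q \<ge> 0 \<and> r \<ge> 0 \<and> a + p *\<^sub>R b + q *\<^sub>R c + r *\<^sub>R d = (0::'a))"

lemma cone_zeroI:
  "p \<ge> 0 \<Longrightarrow> q \<ge> 0 \<Longrightarrow> r \<ge> 0 \<Longrightarrow> a + p *\<^sub>R b + q *\<^sub>R c + r *\<^sub>R d = 0 \<Longrightarrow> cone_zero a b c d"
  unfolding cone_zero_def by blast

text \<open>By \<open>expand\<close>, the inner products with \<open>ai\<close>, \<open>aj\<close>,
  \<open>ak\<close> are the coordinates of a negated vector in the basis \<open>ti\<close>,
  \<open>tj\<close>, \<open>tk\<close>. Along the ray from \<open>s\<close> in direction
  \<open>x\<close> the \<open>i\<close>-th coordinate grows, and \<open>le\<close> says that the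
  \<open>k\<close>-th one vanishes no later than the \<open>j\<close>-th. At that point only
  \<open>ti\<close> and \<open>tj\<close> are left, with nonnegative coefficients.\<close>

lemma cone_zero_side:
  fixes ti :: "real^3"
  assumes expand: "\<And>v. v + ((ai \<bullet> v) *\<^sub>R ti + (aj \<bullet> v) *\<^sub>R tj + (ak \<bullet> v) *\<^sub>R tk) = 0"
    and s: "ai \<bullet> s > 0" "aj \<bullet> s > 0" "ak \<bullet> s > 0"
    and x: "ai \<bullet> x > 0" "aj \<bullet> x < 0 \<or> ak \<bullet> x < 0"
    and le: "(ak \<bullet> s) * (- (aj \<bullet> x)) \<le> (aj \<bullet> s) * (- (ak \<bullet> x))"
  shows "cone_zero s ti tj x"
proof -
  have n: "ak \<bullet> x < 0"
  proof (rule ccontr)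
    assume "\<not> ak \<bullet> x < 0"
    then have "aj \<bullet> x < 0" "(aj \<bullet> s) * (- (ak \<bullet> x)) \<le> 0"
      using x s by (auto simp: mult_nonneg_nonneg)
    moreover from this have "(ak \<bullet> s) * (- (aj \<bullet> x)) > 0" using s by (intro mult_pos_pos) auto
    ultimately show False using le by linarith
  qed
  define l where "l = (ak \<bullet> s) / (- (ak \<bullet> x))"
  have l: "l > 0" unfolding l_def using n s by (intro divide_pos_pos) auto
  have k: "ak \<bullet> (s + l *\<^sub>R x) = 0"
    using n by (simp add: l_def inner_diff_right)
  have "l * (- (aj \<bullet> x)) \<le> aj \<bullet> s"
    unfolding l_def using le n by (simp add: field_simps)
  then have j: "aj \<bullet> (s + l *\<^sub>R x) \<ge> 0"
    by (simp add: inner_add_right)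
  have i: "ai \<bullet> (s + l *\<^sub>R x) \<ge> 0"
    using s(1) x(1) l by (simp add: inner_add_right)
  show ?thesis
    by (rule cone_zeroI[OF i j]) (use l expand[of "s + l *\<^sub>R x"] k in \<open>simp_all add: add_ac\<close>)
qed

text \<open>\<open>b\<close> and \<open>e\<close> are Cramer's solution, with determinant
  \<open>?D\<close>, for which the coordinates \<open>i\<close> and \<open>j\<close> of
  \<open>w = s + e xk + b xj\<close> vanish. Only a multiple of \<open>tk\<close> remains, and
  \<open>u\<close>, positive at \<open>w\<close> and negative at \<open>tk\<close>, determines its
  sign.\<close>

lemma cone_zero_corner:
  fixes ti :: "real^3"
  assumes expand: "\<And>v. v + ((ai \<bullet> v) *\<^sub>R ti + (aj \<bullet> v) *\<^sub>R tj + (ak \<bullet> v) *\<^sub>R tk) = 0"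
    and u: "u \<bullet> tk < 0" "u \<bullet> s > 0" "u \<bullet> xj \<ge> 0" "u \<bullet> xk \<ge> 0"
    and minor: "(ai \<bullet> xj) * (aj \<bullet> xk) - (ai \<bullet> xk) * (aj \<bullet> xj) > 0" (is "?D > 0")
    and d: "(ai \<bullet> s) * (aj \<bullet> xj) - (ai \<bullet> xj) * (aj \<bullet> s) > 0"
    and le: "(aj \<bullet> s) * (- (ai \<bullet> xk)) \<le> (ai \<bullet> s) * (- (aj \<bullet> xk))"
  shows "cone_zero s tk xk xj"
proof -
  define b where "b = ((aj \<bullet> s) * (ai \<bullet> xk) - (ai \<bullet> s) * (aj \<bullet> xk)) / ?D"
  define e where "e = ((ai \<bullet> s) * (aj \<bullet> xj) - (ai \<bullet> xj) * (aj \<bullet> s)) / ?D"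
  have b: "b \<ge> 0" unfolding b_def using le minor by (intro divide_nonneg_pos) auto
  have e: "e \<ge> 0" unfolding e_def using d minor by (intro divide_nonneg_pos) auto
  define w where "w = s + e *\<^sub>R xk + b *\<^sub>R xj"
  have bD: "b * ?D = (aj \<bullet> s) * (ai \<bullet> xk) - (ai \<bullet> s) * (aj \<bullet> xk)" using minor by (simp add: b_def)
  have eD: "e * ?D = (ai \<bullet> s) * (aj \<bullet> xj) - (ai \<bullet> xj) * (aj \<bullet> s)" using minor by (simp add: e_def)
  have "(ai \<bullet> w) * ?D = (ai \<bullet> s) * ?D + (e * ?D) * (ai \<bullet> xk) + (b * ?D) * (ai \<bullet> xj)"
    by (simp add: w_def inner_add_right algebra_simps)
  also have "\<dots> = 0" unfolding bD eD by (simp add: algebra_simps)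
  finally have i0: "ai \<bullet> w = 0" using minor by simp
  have "(aj \<bullet> w) * ?D = (aj \<bullet> s) * ?D + (e * ?D) * (aj \<bullet> xk) + (b * ?D) * (aj \<bullet> xj)"
    by (simp add: w_def inner_add_right algebra_simps)
  also have "\<dots> = 0" unfolding bD eD by (simp add: algebra_simps)
  finally have j0: "aj \<bullet> w = 0" using minor by simp
  have w0: "w + (ak \<bullet> w) *\<^sub>R tk = 0" using expand[of w] i0 j0 by simp
  have "u \<bullet> w > 0"
    using u b e by (simp add: w_def inner_add_right add_pos_nonneg)
  moreover have "u \<bullet> w + (ak \<bullet> w) * (u \<bullet> tk) = 0"
    using arg_cong[OF w0, of "inner u"] by (simp add: inner_add_right)
  ultimately have "(ak \<bullet> w) * (u \<bullet> tk) < 0" by linarith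
  then have "ak \<bullet> w \<ge> 0" using u(1) by (auto simp: mult_less_0_iff)
  then show ?thesis
    by (rule cone_zeroI[OF _ e b]) (use w0 in \<open>simp add: w_def add_ac\<close>)
qed

text \<open>In quotients: p/q < A/B < p'/q'. The sign assumptions first force both \<open>A\<close>
  and \<open>B\<close> to be positive.\<close>

lemma ratio_less:
  fixes A B p q p' q' :: real
  assumes "p > 0" "q > 0" "p' > 0" "q' > 0" "A > 0 \<or> B > 0" "q' * A < p' * B" "p * B < q * A"
  shows "p * q' < p' * q"
proof -
  have B: "B > 0"
  proof (rule ccontr)
    assume "\<not> B > 0"
    then have "A > 0" "p' * B \<le> 0" "q' * A > 0" using assms by (auto simp: mult_le_0_iff)
    then show False using assms(6) by linarith
  qed
  then have "p * B > 0" using assms by simp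
  then have A: "A > 0" using assms(2,7) by (smt (verit) mult_nonneg_nonpos)
  have "(p * q') * (A * B) = (p * B) * (q' * A)" by simp
  also have "\<dots> < (q * A) * (p' * B)"
    by (rule mult_strict_mono) (use assms A B in auto)
  also have "\<dots> = (p' * q) * (A * B)" by simp
  finally show ?thesis using A B by (simp add: mult_less_cancel_right)
qed

text \<open>Multiplying the three inequalities gives the same product on both sides.\<close>

lemma no_cyclic_increase:
  fixes a1 a2 a3 b1 b2 b3 :: real
  assumes "a1 > 0" "a2 > 0" "a3 > 0" "b1 > 0" "b2 > 0" "b3 > 0"
    "a1 * b2 < b1 * a2" "a2 * b3 < b2 * a3" "a3 * b1 < b3 * a1"
  shows False
proof -
  have "(a1 * b2) * (a2 * b3) < (b1 * a2) * (b2 * a3)"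
    by (rule mult_strict_mono) (use assms in auto)
  then have "((a1 * b2) * (a2 * b3)) * (a3 * b1) < ((b1 * a2) * (b2 * a3)) * (b3 * a1)"
    by (rule mult_strict_mono) (use assms in auto)
  then show False by (simp add: mult_ac)
qed

text \<open>In the application, \<open>\<xi>\<close> is the triple just before the collision,
  \<open>t\<close> are the three points below its plane, and \<open>s\<close>, \<open>s'\<close> are
  two points above it. The eight vectors in the two cones carry different labels, so the cones yield
  disjoint index sets.\<close>

lemma two_cones_at_collision:
  fixes t a \<xi> :: "'i \<Rightarrow> real^3"
  assumes X: "x \<noteq> y" "y \<noteq> z" "x \<noteq> z"
    and expand: "\<And>v. v + ((a x \<bullet> v) *\<^sub>R t x + (a y \<bullet> v) *\<^sub>R t y + (a z \<bullet> v) *\<^sub>R t z) = 0"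
    and ut: "\<And>i. i \<in> {x, y, z} \<Longrightarrow> u \<bullet> t i < 0"
    and ux: "\<And>i. i \<in> {x, y, z} \<Longrightarrow> u \<bullet> \<xi> i \<ge> 0"
    and us: "u \<bullet> s > 0" "u \<bullet> s' > 0"
    and as: "\<And>i. i \<in> {x, y, z} \<Longrightarrow> a i \<bullet> s > 0" "\<And>i. i \<in> {x, y, z} \<Longrightarrow> a i \<bullet> s' > 0"
    and diag: "\<And>i. i \<in> {x, y, z} \<Longrightarrow> a i \<bullet> \<xi> i > 0"
    and col: "\<And>i j k. {i, j, k} = {x, y, z} \<Longrightarrow> a j \<bullet> \<xi> i < 0 \<or> a k \<bullet> \<xi> i < 0"
    and minor: "\<And>i j k. {i, j, k} = {x, y, z} \<Longrightarrow>
        (a i \<bullet> \<xi> j) * (a j \<bullet> \<xi> k) - (a i \<bullet> \<xi> k) * (a j \<bullet> \<xi> j) > 0"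
    and d: "\<And>i j r. i \<in> {x, y, z} \<Longrightarrow> j \<in> {x, y, z} \<Longrightarrow> i \<noteq> j \<Longrightarrow> r \<in> {s, s'} \<Longrightarrow>
        (a i \<bullet> r) * (a j \<bullet> \<xi> j) - (a i \<bullet> \<xi> j) * (a j \<bullet> r) > 0"
  obtains i j k p q where "{i, j, k} = {x, y, z}" "{p, q} = {s, s'}"
    "cone_zero p (t i) (t j) (\<xi> i)" "cone_zero q (t k) (\<xi> k) (\<xi> j)"
proof (rule ccontr)
  assume "\<not> thesis"
  note neg = this and result = that
  \<comment> \<open>\<open>P i j k r\<close>: the ray from \<open>r\<close> in direction \<open>\<xi> i\<close> leaves the triangle with vertices \<open>t\<close>
    (seen from the origin in a chart) through the side from \<open>t i\<close> to \<open>t j\<close>.\<close>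
  define P where "P i j k r \<longleftrightarrow> (a k \<bullet> r) * (- (a j \<bullet> \<xi> i)) \<le> (a j \<bullet> r) * (- (a k \<bullet> \<xi> i))" for i j k r
  have perm: "(i, j, k) \<in> {(x,y,z),(x,z,y),(y,x,z),(y,z,x),(z,x,y),(z,y,x)}"
    if ijk: "{i, j, k} = {x, y, z}" for i j k
  proof -
    have "i \<in> {x,y,z}" "j \<in> {x,y,z}" "k \<in> {x,y,z}" using ijk by blast+
    moreover have "x \<in> {i,j,k}" "y \<in> {i,j,k}" "z \<in> {i,j,k}" unfolding ijk by simp_all
    ultimately show ?thesis using X by fast
  qed
  have ex: "v + ((a i \<bullet> v) *\<^sub>R t i + (a j \<bullet> v) *\<^sub>R t j + (a k \<bullet> v) *\<^sub>R t k) = 0"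
    if ijk: "{i, j, k} = {x, y, z}" for i j k v
    using perm[OF ijk] expand[of v] by (auto simp: add_ac)
  \<comment> \<open>For \<open>p\<close> the exit condition is the comparison required by
    \<open>cone_zero_side\<close>; for \<open>q\<close> it is exactly the nonnegativity of the
    Cramer numerator of \<open>b\<close> in \<open>cone_zero_corner\<close>.\<close>
  have no: "\<not> (P i j k p \<and> P k i j q)" if ijk: "{i, j, k} = {x, y, z}" and pq: "{p, q} = {s, s'}" for i j k p q
  proof
    assume PP: "P i j k p \<and> P k i j q"
    have mem: "i \<in> {x,y,z}" "j \<in> {x,y,z}" "k \<in> {x,y,z}" and pqm: "p \<in> {s,s'}" "q \<in> {s,s'}"
      using ijk pq by blast+
    have ne: "i \<noteq> j" using perm[OF ijk] X by auto
    have pos: "a l \<bullet> r > 0" if "l \<in> {x,y,z}" "r \<in> {s,s'}" for l r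
      using as that by auto
    have "cone_zero p (t i) (t j) (\<xi> i)"
    proof (rule cone_zero_side[OF ex[OF ijk]])
      show "(a k \<bullet> p) * (- (a j \<bullet> \<xi> i)) \<le> (a j \<bullet> p) * (- (a k \<bullet> \<xi> i))"
        using PP by (simp only: P_def)
    qed (fact pos[OF mem(1) pqm(1)] pos[OF mem(2) pqm(1)] pos[OF mem(3) pqm(1)] diag[OF mem(1)] col[OF ijk])+
    moreover have "cone_zero q (t k) (\<xi> k) (\<xi> j)"
    proof (rule cone_zero_corner[OF ex[OF ijk]])
      show "(a j \<bullet> q) * (- (a i \<bullet> \<xi> k)) \<le> (a i \<bullet> q) * (- (a j \<bullet> \<xi> k))"
        using PP by (simp only: P_def)
      show "u \<bullet> q > 0" using us pqm(2) by blast
    qed (fact ut[OF mem(3)] ux[OF mem(2)] ux[OF mem(3)] minor[OF ijk] d[OF mem(1,2) ne pqm(2)])+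
    ultimately show False using neg result[OF ijk pq] by blast
  qed
  have tot: "P i j k r \<or> P i k j r" for i j k r by (auto simp: P_def)
  have perms: "{x,z,y} = {x,y,z}" "{y,x,z} = {x,y,z}" "{y,z,x} = {x,y,z}" "{z,x,y} = {x,y,z}" "{z,y,x} = {x,y,z}"
    by auto
  have no': "\<not> (P i j k s' \<and> P k i j s)" "\<not> (P i j k s \<and> P k i j s')" if "{i, j, k} = {x, y, z}" for i j k
    using no[OF that, of s' s] no[OF that, of s s'] by auto
  note N = no'[OF refl] no'[OF perms(1)] no'[OF perms(2)] no'[OF perms(3)] no'[OF perms(4)] no'[OF perms(5)]
  note T = tot[of x y z s] tot[of y z x s] tot[of z x y s] tot[of x y z s'] tot[of y z x s'] tot[of z x y s']
  \<comment> \<open>Read \<open>P i j k r\<close> as: for \<open>r\<close>, the index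
    \<open>i\<close> chooses \<open>j\<close>. The excluded patterns force the choices for
    \<open>s\<close> and for \<open>s'\<close> to be inverse to each other. Without fixed points on
    three indices they are opposite 3-cycles.\<close>
  have "(\<not> P x z y s' \<and> \<not> P y x z s' \<and> \<not> P z y x s' \<and> \<not> P x y z s \<and> \<not> P y z x s \<and> \<not> P z x y s) \<or>
    (\<not> P x z y s \<and> \<not> P y x z s \<and> \<not> P z y x s \<and> \<not> P x y z s' \<and> \<not> P y z x s' \<and> \<not> P z x y s')"
    using N T by argo
  \<comment> \<open>For each \<open>i\<close>, the opposite choices put a ratio of coordinates of
    \<open>\<xi> i\<close> strictly between the corresponding ratios for \<open>r\<close> and
    \<open>r'\<close>, always in the same cyclic direction. This cannot happen all the way round a
    cycle.\<close>
  moreover have False if "r \<in> {s, s'}" "r' \<in> {s, s'}"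
    "\<not> P x z y r'" "\<not> P y x z r'" "\<not> P z y x r'" "\<not> P x y z r" "\<not> P y z x r" "\<not> P z x y r" for r r'
  proof -
    have pos: "a i \<bullet> r > 0" "a i \<bullet> r' > 0" if "i \<in> {x,y,z}" for i
      using as that \<open>r \<in> {s, s'}\<close> \<open>r' \<in> {s, s'}\<close> by auto
    have "(a j \<bullet> r) * (a k \<bullet> r') < (a j \<bullet> r') * (a k \<bullet> r)"
      if "{i, j, k} = {x,y,z}" "\<not> P i k j r'" "\<not> P i j k r" for i j k
      by (rule ratio_less[of _ _ _ _ "- (a j \<bullet> \<xi> i)" "- (a k \<bullet> \<xi> i)"])
        (use that pos[of j] pos[of k] col[OF that(1)] in \<open>auto simp: P_def not_le\<close>)
    from this[OF refl] this[OF perms(3)] this[OF perms(4)] show False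
      using that pos no_cyclic_increase[of "a y \<bullet> r" "a z \<bullet> r" "a x \<bullet> r" "a y \<bullet> r'" "a z \<bullet> r'" "a x \<bullet> r'"]
      by auto
  qed
  ultimately show False by blast
qed

subsection \<open>Splitting families of depth three\<close>

text \<open>From a relation \<open>d\<close> subtract the largest multiple of \<open>c\<close> that
  leaves all coefficients nonnegative. One coefficient becomes zero, and minimality then forces all
  of them to vanish: the relations form a line.\<close>

lemma minimal_circuit:
  fixes v :: "'i \<Rightarrow> 'a::euclidean_space"
  assumes "finite K" "surrounds v K" and min: "\<And>k. k \<in> K \<Longrightarrow> \<not> surrounds v (K - {k})"
  obtains c where "\<forall>i\<in>K. c i > (0::real)" "(\<Sum>i\<in>K. c i *\<^sub>R v i) = 0"
    "\<forall>d. (\<Sum>i\<in>K. d i *\<^sub>R v i) = 0 \<longrightarrow> (\<exists>\<rho>. \<forall>i\<in>K. d i = \<rho> * c i)"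
proof -
  have drop: False if e: "\<And>i. i \<in> K \<Longrightarrow> e i \<ge> 0" "(\<Sum>i\<in>K. e i *\<^sub>R v i) = 0" "k \<in> K" "e k = 0" "l \<in> K" "e l > 0" for e k l
  proof -
    have "(\<Sum>i\<in>K. e i *\<^sub>R v i) = (\<Sum>i\<in>K - {k}. e i *\<^sub>R v i)"
      by (rule sum.mono_neutral_right) (use e assms(1) in auto)
    then have "surrounds v (K - {k})"
      using e assms(1) by (intro surrounds_if_cone[of _ e l]) auto
    then show False using min e(3) by blast
  qed
  obtain c where c: "\<And>i. i \<in> K \<Longrightarrow> 0 \<le> c i" "sum c K = (1::real)" "(\<Sum>i\<in>K. c i *\<^sub>R v i) = 0"
    using assms(2,1) by (rule surroundsE) blast
  obtain l where l: "l \<in> K" "c l > 0"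
    using c(2) sum_nonpos[of K c] by (metis not_le zero_less_one)
  have pos: "c i > 0" if "i \<in> K" for i
    using drop[OF c(1,3) that _ l] c(1)[OF that] by fastforce
  show ?thesis
  proof (rule that[OF _ c(3)])
    show "\<forall>i\<in>K. c i > 0" using pos by blast
    show "\<forall>d. (\<Sum>i\<in>K. d i *\<^sub>R v i) = 0 \<longrightarrow> (\<exists>\<rho>. \<forall>i\<in>K. d i = \<rho> * c i)"
    proof (intro allI impI)
      fix d assume d: "(\<Sum>i\<in>K. d i *\<^sub>R v i) = 0"
      define \<rho> where "\<rho> = Min ((\<lambda>i. d i / c i) ` K)"
      have fin: "finite ((\<lambda>i. d i / c i) ` K)" "(\<lambda>i. d i / c i) ` K \<noteq> {}" using assms(1) l by auto
      obtain k where k: "k \<in> K" "\<rho> = d k / c k" using Min_in[OF fin] unfolding \<rho>_def by blast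
      define e where "e i = d i - \<rho> * c i" for i
      have nn: "e i \<ge> 0" if "i \<in> K" for i
      proof -
        have "\<rho> \<le> d i / c i" unfolding \<rho>_def using fin(1) that by (intro Min_le) auto
        then show ?thesis using pos[OF that] by (simp add: e_def field_simps)
      qed
      have "(\<Sum>i\<in>K. e i *\<^sub>R v i) = (\<Sum>i\<in>K. d i *\<^sub>R v i) - \<rho> *\<^sub>R (\<Sum>i\<in>K. c i *\<^sub>R v i)"
        by (simp add: e_def algebra_simps sum_subtractf scaleR_right.sum)
      then have "(\<Sum>i\<in>K. e i *\<^sub>R v i) = 0" using c d by simp
      moreover have "e k = 0" using k pos[OF k(1)] by (simp add: e_def)
      ultimately have "e i = 0" if "i \<in> K" for i
        using drop[OF nn _ k(1) _ that] nn[OF that] by fastforce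
      then show "\<exists>\<rho>. \<forall>i\<in>K. d i = \<rho> * c i" by (intro exI[of _ \<rho>]) (simp add: e_def)
    qed
  qed
qed

text \<open>The dual basis comes from the adjoint of the inverse coordinate map, so that coordinates
  can be treated as inner products.\<close>

lemma basis3_coordinates:
  fixes a b c :: "real^3"
  assumes indep: "\<And>\<alpha> \<beta> \<gamma>. \<alpha> *\<^sub>R a + \<beta> *\<^sub>R b + \<gamma> *\<^sub>R c = 0 \<Longrightarrow> \<alpha> = 0 \<and> \<beta> = 0 \<and> \<gamma> = 0"
  obtains a' b' c' :: "real^3" where "\<forall>v. v = (a' \<bullet> v) *\<^sub>R a + (b' \<bullet> v) *\<^sub>R b + (c' \<bullet> v) *\<^sub>R c"
proof -
  define f :: "real^3 \<Rightarrow> real^3" where "f w = w $ 1 *\<^sub>R a + w $ 2 *\<^sub>R b + w $ 3 *\<^sub>R c" for w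
  have lin: "linear f" by (rule linearI) (simp_all add: f_def algebra_simps)
  have "inj f"
    unfolding linear_injective_0[OF lin]
  proof (intro allI impI)
    fix w assume "f w = 0"
    then have "w $ 1 = 0 \<and> w $ 2 = 0 \<and> w $ 3 = 0" unfolding f_def by (rule indep)
    then show "w = 0" by (simp add: vec_eq_iff forall_3)
  qed
  then obtain g where g: "linear g" "\<And>v. f (g v) = v"
    using linear_injective_isomorphism[OF lin] by blast
  have "g v $ i = (adjoint g (axis i 1)) \<bullet> v" for v i
    using adjoint_works[OF g(1), of v "axis i 1"] by (simp add: inner_axis inner_commute)
  then have "v = (adjoint g (axis 1 1) \<bullet> v) *\<^sub>R a + (adjoint g (axis 2 1) \<bullet> v) *\<^sub>R b +
      (adjoint g (axis 3 1) \<bullet> v) *\<^sub>R c" for v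
    using g(2)[of v] unfolding f_def by simp
  then show ?thesis using that by blast
qed

text \<open>As \<open>J\<close> is finite, a strictly separating \<open>u\<close> remains strictly
  separating at nearby parameters.\<close>

lemma closed_surrounds:
  fixes w :: "real \<Rightarrow> 'i \<Rightarrow> 'a::euclidean_space"
  assumes "finite J" "\<And>i. i \<in> J \<Longrightarrow> continuous_on UNIV (\<lambda>\<tau>. w \<tau> i)"
  shows "closed {\<tau>. surrounds (w \<tau>) J}"
proof -
  have "open (- {\<tau>. surrounds (w \<tau>) J})"
    unfolding open_subopen[of "- {\<tau>. surrounds (w \<tau>) J}"]
  proof
    fix \<tau> assume "\<tau> \<in> - {\<tau>. surrounds (w \<tau>) J}"
    then have "\<not> surrounds (w \<tau>) J" by simp
    then obtain u where u: "\<And>i. i \<in> J \<Longrightarrow> u \<bullet> w \<tau> i > 0"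
      using assms(1) by (rule not_surroundsE) blast
    define N where "N = (\<Inter>i\<in>J. {\<sigma>. u \<bullet> w \<sigma> i > 0})"
    have "open N"
      unfolding N_def using assms
      by (intro open_INT ballI open_Collect_less continuous_intros) auto
    moreover have "\<tau> \<in> N" using u by (auto simp: N_def)
    moreover have "N \<subseteq> - {\<tau>. surrounds (w \<tau>) J}"
    proof
      fix \<sigma> assume s: "\<sigma> \<in> N"
      have "\<not> surrounds (w \<sigma>) J"
      proof
        assume "surrounds (w \<sigma>) J"
        then obtain i where "i \<in> J" "u \<bullet> w \<sigma> i \<le> 0" using assms(1) by (rule surrounds_inner)
        then show False using s by (auto simp: N_def)
      qed
      then show "\<sigma> \<in> - {\<tau>. surrounds (w \<tau>) J}" by simp
    qed
    ultimately show "\<exists>T. open T \<and> \<tau> \<in> T \<and> T \<subseteq> - {\<tau>. surrounds (w \<tau>) J}" by blast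
  qed
  then show ?thesis by (simp add: closed_def)
qed

lemma eventually_perturb_pos:
  fixes p b :: real
  assumes "p > 0"
  shows "\<forall>\<^sub>F \<delta> in nhds 0. p + \<delta> * b > 0"
proof -
  have "((\<lambda>\<delta>. p + \<delta> * b) \<longlongrightarrow> p + 0 * b) (nhds 0)"
    by (intro tendsto_intros filterlim_ident)
  then show ?thesis using assms by (intro order_tendstoD) auto
qed

section \<open>Families of depth three without a split\<close>

locale unsplittable =
  fixes I :: "'i set" and v :: "'i \<Rightarrow> real^3"
  assumes finI: "finite I" and deep3: "deep 3 I v"
    and nosplit: "\<And>A. A \<subseteq> I \<Longrightarrow> surrounds v A \<Longrightarrow> \<not> surrounds v (I - A)"
begin

text \<open>This replaces general position. A surrounding set of at most three indices would leave a
  surrounding complement, by \<open>deep_split_small\<close> or, if it contains a zero vector, by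
  depth alone.\<close>

lemma no_small:
  assumes "J \<subseteq> I" "card J \<le> 3"
  shows "\<not> surrounds v J"
proof
  assume J: "surrounds v J"
  show False
  proof (cases "\<exists>j\<in>J. v j = 0")
    case True
    then obtain j where j: "j \<in> J" "v j = 0" by blast
    then have "surrounds v {j}" by (simp add: surrounds_singleton)
    moreover have "surrounds v (I - {j})" by (rule deepD[OF deep3]) (use j assms in auto)
    ultimately show False using nosplit[of "{j}"] j assms by blast
  next
    case False
    then have "surrounds v (I - J)"
      using deep_split_small[OF finI deep3 assms J] by blast
    then show False using nosplit[OF assms(1) J] by blast
  qed
qed

lemma circuit4:
  assumes "K \<subseteq> I" "surrounds v K" "card K \<le> 4"
  obtains c where "\<forall>i\<in>K. c i > (0::real)" "(\<Sum>i\<in>K. c i *\<^sub>R v i) = 0"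
    "\<forall>d. (\<Sum>i\<in>K. d i *\<^sub>R v i) = 0 \<longrightarrow> (\<exists>\<rho>. \<forall>i\<in>K. d i = \<rho> * c i)" "card K = 4"
proof -
  have fK: "finite K" using assms(1) finI finite_subset by blast
  have "\<not> card K \<le> 3" using no_small assms by blast
  then have c4: "card K = 4" using assms(3) by simp
  have "\<not> surrounds v (K - {k})" if "k \<in> K" for k
    by (rule no_small) (use assms c4 that fK in auto)
  from minimal_circuit[OF fK assms(2) this] obtain c where
    "\<forall>i\<in>K. c i > (0::real)" "(\<Sum>i\<in>K. c i *\<^sub>R v i) = 0"
    "\<forall>d. (\<Sum>i\<in>K. d i *\<^sub>R v i) = 0 \<longrightarrow> (\<exists>\<rho>. \<forall>i\<in>K. d i = \<rho> * c i)" .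
  from that[OF this c4] show ?thesis .
qed

end

text \<open>
  The direction is chosen as \<open>v t\<close> because \<open>v x + \<tau> v t\<close> lies in the cone of
  \<open>v x\<close> and \<open>v t\<close>: a pair that surrounds the origin at any time would give a surrounding triple
  of the original family, so the first collision is a genuine triple.
\<close>

locale collision = unsplittable I v for I :: "'i set" and v :: "'i \<Rightarrow> real^3" +
  fixes x t :: 'i and \<sigma> :: real and w :: "real \<Rightarrow> 'i \<Rightarrow> real^3"
  defines "w \<equiv> \<lambda>\<tau>. v(x := v x + \<tau> *\<^sub>R v t)"
  assumes xI: "x \<in> I" and tI: "t \<in> I" and xt: "x \<noteq> t" and \<sigma>: "\<sigma> > 0"
    and hit: "\<exists>J\<subseteq>I. card J \<le> 3 \<and> surrounds (w \<sigma>) J"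
    and free: "\<And>\<tau> J. 0 \<le> \<tau> \<Longrightarrow> \<tau> < \<sigma> \<Longrightarrow> J \<subseteq> I \<Longrightarrow> card J \<le> 3 \<Longrightarrow> \<not> surrounds (w \<tau>) J"

lemma (in unsplittable) exists_collision: "\<exists>x t \<sigma>. collision I v x t \<sigma>"
proof -
  have "surrounds v I" using deepD[OF deep3, of "{}"] by simp
  then obtain K where K: "K \<subseteq> I" "finite K" "card K \<le> DIM(real^3) + 1" "surrounds v K"
    by (rule surrounds_caratheodory)
  then have "card K \<le> 4" by simp
  obtain c where c': "\<forall>i\<in>K. c i > (0::real)" and c2: "(\<Sum>i\<in>K. c i *\<^sub>R v i) = 0" "card K = 4"
    by (rule circuit4[OF K(1,4) \<open>card K \<le> 4\<close>])
  have c1: "c i > 0" if "i \<in> K" for i using c' that by blast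
  note c = c1 c2
  have fK: "finite K" using K(1) finI finite_subset by blast
  obtain x where x: "x \<in> K" using c(3) by fastforce
  have "card (K - {x}) = 3" using c(3) x fK by simp
  then obtain t where t: "t \<in> K" "t \<noteq> x" by (metis DiffE card.empty ex_in_conv insertI1 zero_neq_numeral)
  define w where "w = (\<lambda>\<tau>. v(x := v x + \<tau> *\<^sub>R v t))"
  \<comment> \<open>At time \<open>\<gamma>\<close> the moved point absorbs the term of
    \<open>t\<close> in the relation on \<open>K\<close>, so the triple \<open>K - {t}\<close>
    surrounds the origin. A collision therefore happens no later than that.\<close>
  define \<gamma> where "\<gamma> = c t / c x"
  have g: "\<gamma> > 0" using c(1) x t by (simp add: \<gamma>_def)
  have cont: "continuous_on UNIV (\<lambda>\<tau>. w \<tau> i)" for i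
    unfolding w_def by (cases "i = x") (auto intro!: continuous_intros)
  have "(\<Sum>i\<in>K - {t}. c i *\<^sub>R w \<gamma> i) = (\<Sum>i\<in>K - {t} - {x}. c i *\<^sub>R w \<gamma> i) + c x *\<^sub>R w \<gamma> x"
    using x t fK by (subst sum.remove[of _ x]) auto
  also have "(\<Sum>i\<in>K - {t} - {x}. c i *\<^sub>R w \<gamma> i) = (\<Sum>i\<in>K - {t} - {x}. c i *\<^sub>R v i)"
    by (rule sum.cong) (auto simp: w_def)
  also have "c x *\<^sub>R w \<gamma> x = c x *\<^sub>R v x + c t *\<^sub>R v t"
    using c(1)[OF x] by (simp add: w_def \<gamma>_def algebra_simps)
  also have "(\<Sum>i\<in>K - {t} - {x}. c i *\<^sub>R v i) + (c x *\<^sub>R v x + c t *\<^sub>R v t) = (\<Sum>i\<in>K. c i *\<^sub>R v i)"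
    using x t fK by (simp add: sum.remove[of K t] sum.remove[of "K - {t}" x] algebra_simps)
  finally have "surrounds (w \<gamma>) (K - {t})"
    using c x t fK by (intro surrounds_if_cone[of _ c x]) (auto intro: less_imp_le)
  moreover have "K - {t} \<subseteq> I" "card (K - {t}) \<le> 3" using K c(3) t fK by auto
  ultimately have hit: "\<exists>J\<subseteq>I. card J \<le> 3 \<and> surrounds (w \<gamma>) J" by blast
  \<comment> \<open>The collision times up to \<open>\<gamma>\<close> form a compact set, a finite
    union of closed sets cut down to an interval, so there is a first one. It is not 0, by
    \<open>no_small\<close>.\<close>
  define E where "E = {0..\<gamma>} \<inter> (\<Union>J\<in>{J. J \<subseteq> I \<and> card J \<le> 3}. {\<tau>. surrounds (w \<tau>) J})"
  have "closed (\<Union>J\<in>{J. J \<subseteq> I \<and> card J \<le> 3}. {\<tau>. surrounds (w \<tau>) J})"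
    using finI finite_subset[OF _ finI] cont by (intro closed_UN ballI closed_surrounds) auto
  then have "compact E" unfolding E_def by (intro compact_Int_closed) auto
  moreover have "\<gamma> \<in> {0..\<gamma>}" using g by simp
  then have "\<gamma> \<in> E" unfolding E_def using hit by blast
  then have "E \<noteq> {}" by blast
  ultimately obtain \<sigma> where s: "\<sigma> \<in> E" "\<And>\<tau>. \<tau> \<in> E \<Longrightarrow> \<sigma> \<le> \<tau>"
    using compact_attains_inf by metis
  have "w 0 = v" by (auto simp: w_def)
  then have "\<sigma> \<noteq> 0" using s(1) no_small by (auto simp: E_def)
  then have "\<sigma> > 0" using s(1) by (auto simp: E_def)
  have "collision I v x t \<sigma>"
  proof
    show "x \<in> I" "t \<in> I" "x \<noteq> t" "\<sigma> > 0" using x t K \<open>\<sigma> > 0\<close> by auto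
    show "\<exists>J\<subseteq>I. card J \<le> 3 \<and> surrounds (v(x := v x + \<sigma> *\<^sub>R v t)) J"
      using s(1) by (auto simp: E_def w_def)
    show "\<not> surrounds (v(x := v x + \<tau> *\<^sub>R v t)) J" if "0 \<le> \<tau>" "\<tau> < \<sigma>" "J \<subseteq> I" "card J \<le> 3" for \<tau> J
    proof
      assume "surrounds (v(x := v x + \<tau> *\<^sub>R v t)) J"
      moreover have "\<tau> \<le> \<gamma>" using that s(1) by (simp add: E_def)
      ultimately have "\<tau> \<in> E" using that by (auto simp: E_def w_def)
      then show False using s(2)[of \<tau>] that by simp
    qed
  qed
  then show ?thesis by blast
qed

section \<open>Surrounding sets during the motion\<close>

context collision
begin

lemma w0 [simp]: "w 0 = v"
  by (auto simp: w_def)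

lemma w_other [simp]: "i \<noteq> x \<Longrightarrow> w \<tau> i = v i"
  by (simp add: w_def)

lemma w_x: "w \<tau> x = v x + \<tau> *\<^sub>R v t"
  by (simp add: w_def)

lemma surrounds_w_other: "x \<notin> J \<Longrightarrow> surrounds (w \<tau>) J = surrounds v J"
  by (rule surrounds_cong) (metis w_other)

lemma closed_surrounds_w: "J \<subseteq> I \<Longrightarrow> closed {\<tau>. surrounds (w \<tau>) J}"
proof (rule closed_surrounds)
  show "continuous_on UNIV (\<lambda>\<tau>. w \<tau> i)" for i
    unfolding w_def by (cases "i = x") (auto intro!: continuous_intros)
qed (rule finite_subset[OF _ finI])

text \<open>Before the collision, a surrounding set of at most four indices has exactly four. If it
  contains \<open>x\<close>, the other three vectors form a basis; the shift of \<open>x\<close> is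
  expressed in this basis and absorbed by small changes of positive coefficients.\<close>

lemma open_surrounds_w:
  assumes "J \<subseteq> I" "0 \<le> \<tau>" "\<tau> < \<sigma>" "surrounds (w \<tau>) J"
  shows "\<forall>\<^sub>F \<tau>' in nhds \<tau>. surrounds (w \<tau>') J"
proof -
  obtain K where K: "K \<subseteq> J" "finite K" "card K \<le> DIM(real^3) + 1" "surrounds (w \<tau>) K"
    using assms(4) by (rule surrounds_caratheodory)
  have KI: "K \<subseteq> I" using K assms by blast
  have "\<forall>\<^sub>F \<tau>' in nhds \<tau>. surrounds (w \<tau>') K"
  proof (cases "x \<in> K")
    case False
    then show ?thesis using K(4) by (simp add: surrounds_w_other)
  next
    case True
    have "\<not> card K \<le> 3" using free[OF assms(2,3) KI] K(4) by blast
    then have c4: "card K = 4" using K(3) by simp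
    have "\<not> surrounds (w \<tau>) (K - {k})" if "k \<in> K" for k
      by (rule free) (use assms KI c4 that K(2) in auto)
    then obtain c where c': "\<forall>i\<in>K. c i > (0::real)" and c2: "(\<Sum>i\<in>K. c i *\<^sub>R w \<tau> i) = 0"
      and c3: "\<forall>d. (\<Sum>i\<in>K. d i *\<^sub>R w \<tau> i) = 0 \<longrightarrow> (\<exists>\<rho>. \<forall>i\<in>K. d i = \<rho> * c i)"
      by (rule minimal_circuit[OF K(2,4)])
    have c1: "c i > 0" if "i \<in> K" for i using c' that by blast
    note c = c1 c2 c3[rule_format]
    have "card (K - {x}) = 3" using c4 True K(2) by simp
    then obtain p q r where pqr: "K - {x} = {p, q, r}" "p \<noteq> q" "q \<noteq> r" "p \<noteq> r" using card_3_iff by metis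
    then have Keq: "K = {x, p, q, r}" "x \<noteq> p" "x \<noteq> q" "x \<noteq> r" using True by auto
    have sumK: "(\<Sum>i\<in>K. d i *\<^sub>R w \<tau>' i) = d x *\<^sub>R w \<tau>' x + d p *\<^sub>R v p + d q *\<^sub>R v q + d r *\<^sub>R v r" for d \<tau>'
      using Keq pqr by (simp add: add_ac)
    have "\<alpha> = 0 \<and> \<beta> = 0 \<and> \<gamma> = 0" if "\<alpha> *\<^sub>R v p + \<beta> *\<^sub>R v q + \<gamma> *\<^sub>R v r = 0" for \<alpha> \<beta> \<gamma>
    proof -
      define d where "d i = (if i = p then \<alpha> else if i = q then \<beta> else if i = r then \<gamma> else 0)" for i
      have "(\<Sum>i\<in>K. d i *\<^sub>R w \<tau> i) = 0" unfolding sumK using that Keq pqr by (simp add: d_def)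
      then obtain \<rho> where \<rho>: "\<forall>i\<in>K. d i = \<rho> * c i" using c(3) by blast
      then have "\<rho> * c x = 0" using True Keq by (auto simp: d_def)
      then have "\<rho> = 0" using c(1)[OF True] by simp
      then have "d p = 0" "d q = 0" "d r = 0" using \<rho> Keq by auto
      then show ?thesis using pqr by (auto simp: d_def)
    qed
    then obtain p' q' r' where "\<forall>v'. v' = (p' \<bullet> v') *\<^sub>R v p + (q' \<bullet> v') *\<^sub>R v q + (r' \<bullet> v') *\<^sub>R v r"
      by (rule basis3_coordinates)
    note e = this[rule_format]
    have ev: "\<forall>\<^sub>F \<delta> in nhds 0. c i + \<delta> * (- (c x * b)) > 0" if "i \<in> K" for i b
      by (rule eventually_perturb_pos) (use c(1) that in auto)
    have "\<forall>\<^sub>F \<delta> in nhds 0. c p + \<delta> * (- (c x * (p' \<bullet> v t))) > 0 \<and>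
        c q + \<delta> * (- (c x * (q' \<bullet> v t))) > 0 \<and> c r + \<delta> * (- (c x * (r' \<bullet> v t))) > 0"
      by (intro eventually_conj ev) (auto simp: Keq)
    then have "\<forall>\<^sub>F \<delta> in nhds 0. surrounds (w (\<tau> + \<delta>)) K"
    proof eventually_elim
      case (elim \<delta>)
      define d where "d i = (if i = x then c x else if i = p then c p + \<delta> * (- (c x * (p' \<bullet> v t)))
        else if i = q then c q + \<delta> * (- (c x * (q' \<bullet> v t))) else c r + \<delta> * (- (c x * (r' \<bullet> v t))))" for i
      have "(\<Sum>i\<in>K. d i *\<^sub>R w (\<tau> + \<delta>) i) = (\<Sum>i\<in>K. c i *\<^sub>R w \<tau> i) +
          (\<delta> * c x) *\<^sub>R (v t - ((p' \<bullet> v t) *\<^sub>R v p + (q' \<bullet> v t) *\<^sub>R v q + (r' \<bullet> v t) *\<^sub>R v r))"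
        unfolding sumK using Keq pqr by (simp add: d_def w_x algebra_simps)
      also have "\<dots> = 0" using c(2) e[of "v t"] by simp
      finally show ?case
        using elim c(1)[OF True] Keq pqr K(2)
        by (intro surrounds_if_cone[of K d x]) (auto simp: d_def less_imp_le)
    qed
    moreover have "filterlim (\<lambda>\<tau>'. \<tau>' - \<tau>) (nhds 0) (nhds \<tau>)"
      by (rule tendsto_eq_intros filterlim_ident | simp)+
    ultimately have "\<forall>\<^sub>F \<tau>' in nhds \<tau>. surrounds (w (\<tau> + (\<tau>' - \<tau>))) K"
      by (rule eventually_compose_filterlim)
    then show ?thesis by simp
  qed
  then show ?thesis by (rule eventually_mono) (use K(1) surrounds_mono in blast)
qed

text \<open>On the connected interval before \<open>\<sigma>\<close>, the times at which
  \<open>J\<close> surrounds the origin form a set that is both open and closed.\<close>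

lemma surrounds_constant:
  assumes J: "J \<subseteq> I" and \<tau>: "0 \<le> \<tau>" "\<tau> < \<sigma>" "0 \<le> \<tau>'" "\<tau>' < \<sigma>" and s: "surrounds (w \<tau>) J"
  shows "surrounds (w \<tau>') J"
proof -
  let ?S = "{0..<\<sigma>}" and ?K = "{\<tau>. surrounds (w \<tau>) J}"
  have "closedin (top_of_set ?S) (?S \<inter> ?K)"
    using closed_surrounds_w[OF J] by (rule closedin_closed_Int)
  moreover have "openin (top_of_set ?S) (?S \<inter> ?K)"
    unfolding openin_subopen[of _ "?S \<inter> ?K"]
  proof
    fix \<tau> assume "\<tau> \<in> ?S \<inter> ?K"
    then have "\<forall>\<^sub>F \<tau>' in nhds \<tau>. surrounds (w \<tau>') J" "\<tau> \<in> ?S"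
      using open_surrounds_w[OF J] by auto
    then obtain U where "open U" "\<tau> \<in> U" "\<And>\<tau>'. \<tau>' \<in> U \<Longrightarrow> surrounds (w \<tau>') J"
      unfolding eventually_nhds by blast
    then show "\<exists>T. openin (top_of_set ?S) T \<and> \<tau> \<in> T \<and> T \<subseteq> ?S \<inter> ?K"
      using \<open>\<tau> \<in> ?S\<close> by (intro exI[of _ "?S \<inter> U"]) (auto intro: openin_open_Int)
  qed
  moreover have "connected ?S" by simp
  ultimately have "?S \<inter> ?K = {} \<or> ?S \<inter> ?K = ?S"
    unfolding connected_clopen by blast
  moreover have "\<tau> \<in> ?S \<inter> ?K" "\<tau>' \<in> ?S" using \<tau> s by simp_all
  ultimately have "\<tau>' \<in> ?S \<inter> ?K" by blast
  then show ?thesis by simp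
qed

lemma surrounds_before:
  assumes "J \<subseteq> I" "0 \<le> \<tau>" "\<tau> < \<sigma>" "surrounds (w \<tau>) J"
  shows "surrounds v J"
  using surrounds_constant[OF assms(1-3) order_refl \<sigma> assms(4)] by simp

text \<open>Closedness carries surrounding sets, and with them depth, to time
  \<open>\<sigma>\<close>. The converse fails there: the colliding triple is a new surrounding
  set.\<close>

lemma surrounds_limit:
  assumes J: "J \<subseteq> I" "surrounds v J"
  shows "surrounds (w \<sigma>) J"
proof -
  have "{0..<\<sigma>} \<subseteq> {\<tau>. surrounds (w \<tau>) J}"
    using surrounds_constant[OF J(1) order_refl \<sigma>] J(2) by auto
  then have "closure {0..<\<sigma>} \<subseteq> {\<tau>. surrounds (w \<tau>) J}"
    using closed_surrounds_w[OF J(1)] by (rule closure_minimal)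
  moreover have "\<sigma> \<in> closure {0..<\<sigma>}" using \<sigma> by simp
  ultimately show ?thesis by blast
qed

lemma deep3_limit: "deep 3 I (w \<sigma>)"
  using deep3 surrounds_limit by (auto simp: deep_def)

lemma no_pair:
  assumes "J \<subseteq> I" "card J \<le> 2"
  shows "\<not> surrounds (w \<sigma>) J"
proof
  assume s: "surrounds (w \<sigma>) J"
  have fJ: "finite J" using assms finI finite_subset by blast
  show False
  proof (cases "x \<in> J")
    case False
    then show False using s no_small[of J] assms by (simp add: surrounds_w_other)
  next
    case True
    obtain c where c: "\<And>i. i \<in> J \<Longrightarrow> 0 \<le> c i" "sum c J = (1::real)" "(\<Sum>i\<in>J. c i *\<^sub>R w \<sigma> i) = 0"
      using s fJ by (rule surroundsE) blast
    define c0 where "c0 i = (if i \<in> J then c i else 0)" for i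
    define d where "d i = c0 i + (if i = t then \<sigma> * c x else 0)" for i
    have "(\<Sum>i\<in>insert t J. d i *\<^sub>R v i) = (\<Sum>i\<in>insert t J. c0 i *\<^sub>R v i) + (\<sigma> * c x) *\<^sub>R v t"
      using fJ by (simp add: d_def scaleR_add_left sum.distrib if_distrib[of "\<lambda>a. a *\<^sub>R _"] cong: if_cong)
    also have "(\<Sum>i\<in>insert t J. c0 i *\<^sub>R v i) = (\<Sum>i\<in>J. c i *\<^sub>R v i)"
      using fJ by (intro sum.mono_neutral_cong_right) (auto simp: c0_def)
    also have "\<dots> + (\<sigma> * c x) *\<^sub>R v t = (\<Sum>i\<in>J. c i *\<^sub>R w \<sigma> i)"
      using fJ True by (simp add: sum.remove[of J x] w_x algebra_simps)
    finally have z: "(\<Sum>i\<in>insert t J. d i *\<^sub>R v i) = 0" using c by simp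
    obtain l where l: "l \<in> J" "c l > 0"
      using c(2) sum_nonpos[of J c] by (metis not_le zero_less_one)
    have nn: "\<sigma> * c x \<ge> 0" using c(1)[OF True] \<sigma> by simp
    have "surrounds v (insert t J)"
      by (rule surrounds_if_cone[OF _ _ _ _ z, of l])
        (use l c fJ nn in \<open>auto simp: d_def c0_def intro: add_pos_nonneg\<close>)
    moreover have "card (insert t J) \<le> 3" using assms(2) card_insert_le_m1[of 3 J t] by simp
    ultimately show False using no_small[of "insert t J"] assms(1) tI by auto
  qed
qed

text \<open>Caratheodory's theorem in a plane would produce a surrounding triple of the original
  family.\<close>

lemma plane_free:
  assumes "J \<subseteq> I" "u \<noteq> 0" "\<And>i. i \<in> J \<Longrightarrow> u \<bullet> v i = 0"
  shows "\<not> surrounds v J"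
proof
  assume "surrounds v J"
  then obtain K where "K \<subseteq> J" "finite K" "card K \<le> DIM(real^3)" "surrounds v K"
    using assms(2,3) by (rule surrounds_caratheodory_plane)
  then show False using no_small[of K] assms(1) by auto
qed

lemma collision_triple:
  obtains y z where "y \<in> I" "z \<in> I" "x \<noteq> y" "y \<noteq> z" "x \<noteq> z" "surrounds (w \<sigma>) {x, y, z}"
proof -
  obtain J where J: "J \<subseteq> I" "card J \<le> 3" "surrounds (w \<sigma>) J" using hit by blast
  have "\<not> card J \<le> 2" using no_pair J by blast
  then have c3: "card J = 3" using J(2) by simp
  have xJ: "x \<in> J"
  proof (rule ccontr)
    assume "x \<notin> J"
    then show False using J no_small[of J] by (simp add: surrounds_w_other)
  qed
  then have "card (J - {x}) = 2" using c3 by simp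
  then obtain y z where yz: "J - {x} = {y, z}" "y \<noteq> z" unfolding card_2_iff by blast
  then have "J = {x, y, z}" using xJ by blast
  moreover have "x \<noteq> y" "x \<noteq> z" using yz by blast+
  ultimately show ?thesis using that[of y z] yz(2) J(1,3) by simp
qed

end

lemma eventually_small_positive:
  fixes P :: "real \<Rightarrow> bool"
  assumes "\<forall>\<^sub>F \<delta> in nhds 0. P \<delta>" "\<sigma> > 0"
  obtains \<delta> where "0 < \<delta>" "\<delta> < \<sigma>" "P \<delta>"
proof -
  obtain d where d: "d > 0" "\<And>x. dist x 0 < d \<Longrightarrow> P x"
    using assms(1) unfolding eventually_nhds_metric by blast
  have "P (min d \<sigma> / 2)" by (rule d(2)) (use d(1) assms(2) in auto)
  then show ?thesis using that[of "min d \<sigma> / 2"] d(1) assms(2) by (simp add: min_def)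
qed

section \<open>The plane of the colliding triple\<close>

locale coplanar_collision = collision I v x t \<sigma> w
  for I :: "'i set" and v :: "'i \<Rightarrow> real^3" and x t \<sigma> w +
  fixes y z :: 'i
  assumes yI: "y \<in> I" and zI: "z \<in> I" and xy: "x \<noteq> y" and yz: "y \<noteq> z" and xz: "x \<noteq> z"
    and triple: "surrounds (w \<sigma>) {x, y, z}"
begin

lemma circuit_xyz:
  obtains c where "\<forall>i\<in>{x, y, z}. c i > (0::real)" "(\<Sum>i\<in>{x, y, z}. c i *\<^sub>R w \<sigma> i) = 0"
    "\<forall>d. (\<Sum>i\<in>{x, y, z}. d i *\<^sub>R w \<sigma> i) = 0 \<longrightarrow> (\<exists>\<rho>. \<forall>i\<in>{x, y, z}. d i = \<rho> * c i)"
proof -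
  have "\<not> surrounds (w \<sigma>) ({x, y, z} - {k})" if "k \<in> {x, y, z}" for k
    by (rule no_pair) (use that xI yI zI xy yz xz in \<open>auto simp: card_insert_if\<close>)
  from minimal_circuit[OF _ triple this] that show ?thesis by blast
qed

lemma sum_xyz: "(\<Sum>i\<in>{x, y, z}. f i) = f x + f y + (f z :: 'b::ab_group_add)"
  using xy yz xz by (simp add: add_ac)

lemma wx_eq:
  obtains \<mu> \<nu> where "\<mu> > 0" "\<nu> > 0" "w \<sigma> x = - (\<mu> *\<^sub>R v y + \<nu> *\<^sub>R v z)"
proof -
  obtain c where c: "\<forall>i\<in>{x, y, z}. c i > (0::real)" "(\<Sum>i\<in>{x, y, z}. c i *\<^sub>R w \<sigma> i) = 0"
    by (rule circuit_xyz)
  have "c x *\<^sub>R w \<sigma> x + (c y *\<^sub>R v y + c z *\<^sub>R v z) = 0"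
    using c(2) xy xz unfolding sum_xyz by (simp add: add_ac)
  then have "c x *\<^sub>R w \<sigma> x = - (c y *\<^sub>R v y + c z *\<^sub>R v z)"
    by (rule eq_neg_iff_add_eq_0[THEN iffD2])
  then have "(1 / c x) *\<^sub>R (c x *\<^sub>R w \<sigma> x) = (1 / c x) *\<^sub>R (- (c y *\<^sub>R v y + c z *\<^sub>R v z))" by simp
  then have "w \<sigma> x = - ((c y / c x) *\<^sub>R v y + (c z / c x) *\<^sub>R v z)"
    using c(1) by (simp add: scaleR_diff_right)
  then show ?thesis using that[of "c y / c x" "c z / c x"] c(1) by simp
qed

lemma yz_independent:
  assumes "\<alpha> *\<^sub>R v y + \<beta> *\<^sub>R v z = 0"
  shows "\<alpha> = 0 \<and> \<beta> = 0"
proof -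
  obtain c where c: "\<forall>i\<in>{x, y, z}. c i > (0::real)"
    "\<forall>d. (\<Sum>i\<in>{x, y, z}. d i *\<^sub>R w \<sigma> i) = 0 \<longrightarrow> (\<exists>\<rho>. \<forall>i\<in>{x, y, z}. d i = \<rho> * c i)"
    by (rule circuit_xyz)
  define d where "d i = (if i = x then 0 else if i = y then \<alpha> else \<beta>)" for i
  have "(\<Sum>i\<in>{x, y, z}. d i *\<^sub>R w \<sigma> i) = 0"
    unfolding sum_xyz using assms xy xz yz by (simp add: d_def)
  then obtain \<rho> where r: "\<forall>i\<in>{x, y, z}. d i = \<rho> * c i" using c(2) by blast
  then have "d x = \<rho> * c x" by blast
  then have "\<rho> = 0" using c(1) by (simp add: d_def)
  then have "d y = 0" "d z = 0" using r by auto
  then show ?thesis using xy xz yz by (auto simp: d_def)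
qed

lemma plane_basis:
  assumes "u \<bullet> v y = 0" "u \<bullet> v z = 0" "u \<bullet> r \<noteq> 0"
  obtains a b c where "\<forall>p. p = (a \<bullet> p) *\<^sub>R v y + (b \<bullet> p) *\<^sub>R v z + (c \<bullet> p) *\<^sub>R r"
proof (rule basis3_coordinates[of "v y" "v z" r])
  fix \<alpha> \<beta> \<gamma> assume *: "\<alpha> *\<^sub>R v y + \<beta> *\<^sub>R v z + \<gamma> *\<^sub>R r = 0"
  then have "u \<bullet> (\<alpha> *\<^sub>R v y + \<beta> *\<^sub>R v z + \<gamma> *\<^sub>R r) = 0" by simp
  then have "\<gamma> = 0" using assms by (simp add: inner_add_right)
  then show "\<alpha> = 0 \<and> \<beta> = 0 \<and> \<gamma> = 0" using * yz_independent by simp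
qed (rule that)

text \<open>If \<open>v x\<close> were in the plane, \<open>v t\<close> would be in it as well, and
  small changes of \<open>\<mu>\<close> and \<open>\<nu>\<close> would make the triple surround the
  origin already before \<open>\<sigma>\<close>. Passing to \<open>- u\<close> fixes the
  sign.\<close>

lemma exists_normal:
  obtains u where "u \<bullet> v y = 0" "u \<bullet> v z = 0" "u \<bullet> v x > 0"
proof -
  have "dim {v y, v z} \<le> card {v y, v z}" by (rule dim_le_card) (auto intro: span_base)
  also have "\<dots> \<le> 2" by (simp add: card_insert_if)
  finally have "dim {v y, v z} < DIM(real^3)" by simp
  then obtain u where u: "u \<noteq> 0" "\<And>p. p \<in> span {v y, v z} \<Longrightarrow> orthogonal u p"
    by (rule orthogonal_to_subspace_exists) blast
  have uyz: "u \<bullet> v y = 0" "u \<bullet> v z = 0" using u(2) by (auto simp: orthogonal_def intro: span_base)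
  have "u \<bullet> v x \<noteq> 0"
  proof
    assume ux: "u \<bullet> v x = 0"
    obtain \<mu> \<nu> where mn: "\<mu> > 0" "\<nu> > 0" "w \<sigma> x = - (\<mu> *\<^sub>R v y + \<nu> *\<^sub>R v z)" by (rule wx_eq)
    have "u \<bullet> w \<sigma> x = 0" unfolding mn(3) using uyz by (simp add: inner_diff_right)
    then have ut: "u \<bullet> v t = 0" using ux \<sigma> by (simp add: w_x inner_add_right)
    obtain a b c where abc: "\<forall>p. p = (a \<bullet> p) *\<^sub>R v y + (b \<bullet> p) *\<^sub>R v z + (c \<bullet> p) *\<^sub>R u"
      by (rule plane_basis[OF uyz, of u]) (use u(1) in auto)
    have t: "v t = (a \<bullet> v t) *\<^sub>R v y + (b \<bullet> v t) *\<^sub>R v z + (c \<bullet> v t) *\<^sub>R u" using abc by blast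
    have "u \<bullet> v t = (c \<bullet> v t) * (u \<bullet> u)"
      by (subst t) (simp add: inner_add_right uyz)
    then have "c \<bullet> v t = 0" using ut u(1) by simp
    then have t: "v t = (a \<bullet> v t) *\<^sub>R v y + (b \<bullet> v t) *\<^sub>R v z" using t by simp
    have "\<forall>\<^sub>F \<delta> in nhds 0. \<mu> + \<delta> * (a \<bullet> v t) > 0 \<and> \<nu> + \<delta> * (b \<bullet> v t) > 0"
      by (intro eventually_conj eventually_perturb_pos mn)
    then obtain \<delta> where d: "0 < \<delta>" "\<delta> < \<sigma>" "\<mu> + \<delta> * (a \<bullet> v t) > 0" "\<nu> + \<delta> * (b \<bullet> v t) > 0"
      using eventually_small_positive[OF _ \<sigma>] by blast
    have wd: "w (\<sigma> - \<delta>) x = w \<sigma> x - \<delta> *\<^sub>R v t" by (simp add: w_x algebra_simps)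
    define e where "e i = (if i = x then 1 else if i = y then \<mu> + \<delta> * (a \<bullet> v t) else \<nu> + \<delta> * (b \<bullet> v t))" for i
    have "(\<Sum>i\<in>{x, y, z}. e i *\<^sub>R w (\<sigma> - \<delta>) i) =
        \<delta> *\<^sub>R ((a \<bullet> v t) *\<^sub>R v y + (b \<bullet> v t) *\<^sub>R v z) - \<delta> *\<^sub>R v t"
      unfolding sum_xyz wd mn(3) using xy xz yz by (simp add: e_def algebra_simps)
    also have "\<dots> = 0" using t by simp
    finally have "surrounds (w (\<sigma> - \<delta>)) {x, y, z}"
      by (intro surrounds_if_cone[of _ e x]) (use d xy xz yz in \<open>auto simp: e_def\<close>)
    moreover have "\<not> surrounds (w (\<sigma> - \<delta>)) {x, y, z}"
      by (rule free) (use d xI yI zI in \<open>auto simp: card_insert_if\<close>)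
    ultimately show False by blast
  qed
  then consider "u \<bullet> v x > 0" | "(- u) \<bullet> v x > 0" by fastforce
  then show ?thesis using that[of u] that[of "- u"] uyz by cases auto
qed

end

section \<open>The two sides of the plane\<close>

locale oriented_collision = coplanar_collision I v x t \<sigma> w y z
  for I :: "'i set" and v :: "'i \<Rightarrow> real^3" and x t \<sigma> w y z +
  fixes u :: "real^3"
  assumes uy: "u \<bullet> v y = 0" and uz: "u \<bullet> v z = 0" and ux: "u \<bullet> v x > 0"
begin

text \<open>As \<open>u\<close> is positive at \<open>v x\<close>, the set \<open>S\<close> lies on
  the side from which \<open>x\<close> approaches, and \<open>T\<close> on the side of
  \<open>v t\<close>. Indices of \<open>R\<close> in the plane itself belong to neither; they are
  ruled out only in \<open>R_eq\<close>.\<close>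

definition "R = I - {x, y, z}"
definition "T = {r \<in> R. u \<bullet> v r < 0}"
definition "S = {r \<in> R. u \<bullet> v r > 0}"

lemma fin: "finite R" "finite T" "finite S"
  using finI by (auto simp: R_def T_def S_def)

lemma T_sub: "T \<subseteq> R" and S_sub: "S \<subseteq> R" and R_sub: "R \<subseteq> I"
  by (auto simp: R_def T_def S_def)

lemma u_nz: "u \<noteq> 0"
  using ux by auto

lemma uwx: "u \<bullet> w \<sigma> x = 0"
proof -
  obtain \<mu> \<nu> where "w \<sigma> x = - (\<mu> *\<^sub>R v y + \<nu> *\<^sub>R v z)" by (rule wx_eq)
  then show ?thesis using uy uz by (simp add: inner_diff_right)
qed

lemma ut: "u \<bullet> v t < 0"
proof -
  have "u \<bullet> v x + \<sigma> * (u \<bullet> v t) = 0" using uwx by (simp add: w_x inner_add_right)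
  then have "\<sigma> * (u \<bullet> v t) < 0" using ux by linarith
  then show ?thesis using \<sigma> by (simp add: mult_less_0_iff)
qed

lemma uw_before:
  assumes "\<tau> \<le> \<sigma>" shows "u \<bullet> w \<tau> x \<ge> 0"
proof -
  have "u \<bullet> w \<tau> x = u \<bullet> w \<sigma> x - (\<sigma> - \<tau>) * (u \<bullet> v t)"
    by (simp add: w_x inner_add_right algebra_simps)
  moreover have "(\<sigma> - \<tau>) * (u \<bullet> v t) \<le> 0" using assms ut by (simp add: mult_le_0_iff)
  ultimately show ?thesis using uwx by linarith
qed

text \<open>At time \<open>\<sigma>\<close> the triple can be split off by
  \<open>deep_split_small\<close>, and its complement does not contain the moving point.\<close>

lemma surrounds_R: "surrounds v R"
proof -
  have "surrounds (w \<sigma>) R"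
    unfolding R_def
  proof (rule deep_split_small[OF finI deep3_limit _ _ triple])
    show "w \<sigma> j \<noteq> 0" if "j \<in> {x, y, z}" for j
      using no_pair[of "{j}"] that xI yI zI by (auto simp: surrounds_singleton)
  qed (use xI yI zI in \<open>auto simp: card_insert_if\<close>)
  then show ?thesis by (simp add: surrounds_w_other R_def)
qed

text \<open>At time \<open>\<sigma> - \<delta>\<close> the relation of the triple misses zero by
  \<open>\<delta>\<close> times \<open>v t\<close>. Since \<open>v r\<close> is on the same side as
  \<open>v t\<close>, a positive multiple of \<open>v r\<close> and small changes of
  \<open>\<mu>\<close> and \<open>\<nu>\<close> close this gap.\<close>

lemma surrounds_xyz_T:
  assumes r: "r \<in> T"
  shows "surrounds v {x, y, z, r}"
proof -
  have ne: "r \<noteq> x" "r \<noteq> y" "r \<noteq> z" "r \<in> I" and ur: "u \<bullet> v r < 0" using r by (auto simp: T_def R_def)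
  obtain a b c where abc: "\<forall>p. p = (a \<bullet> p) *\<^sub>R v y + (b \<bullet> p) *\<^sub>R v z + (c \<bullet> p) *\<^sub>R v r"
    by (rule plane_basis[OF uy uz, of "v r"]) (use ur in auto)
  have t: "v t = (a \<bullet> v t) *\<^sub>R v y + (b \<bullet> v t) *\<^sub>R v z + (c \<bullet> v t) *\<^sub>R v r" using abc by blast
  have "u \<bullet> v t = (c \<bullet> v t) * (u \<bullet> v r)"
    by (subst t) (simp add: inner_add_right uy uz)
  then have c: "c \<bullet> v t > 0" using ut ur by (metis mult_less_0_iff not_less_iff_gr_or_eq)
  obtain \<mu> \<nu> where mn: "\<mu> > 0" "\<nu> > 0" "w \<sigma> x = - (\<mu> *\<^sub>R v y + \<nu> *\<^sub>R v z)" by (rule wx_eq)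
  have "\<forall>\<^sub>F \<delta> in nhds 0. \<mu> + \<delta> * (a \<bullet> v t) > 0 \<and> \<nu> + \<delta> * (b \<bullet> v t) > 0"
    by (intro eventually_conj eventually_perturb_pos mn)
  then obtain \<delta> where d: "0 < \<delta>" "\<delta> < \<sigma>" "\<mu> + \<delta> * (a \<bullet> v t) > 0" "\<nu> + \<delta> * (b \<bullet> v t) > 0"
    using eventually_small_positive[OF _ \<sigma>] by blast
  have wd: "w (\<sigma> - \<delta>) x = w \<sigma> x - \<delta> *\<^sub>R v t" by (simp add: w_x algebra_simps)
  define e where "e i = (if i = x then 1 else if i = y then \<mu> + \<delta> * (a \<bullet> v t)
    else if i = z then \<nu> + \<delta> * (b \<bullet> v t) else \<delta> * (c \<bullet> v t))" for i
  have "(\<Sum>i\<in>{x, y, z, r}. e i *\<^sub>R w (\<sigma> - \<delta>) i) =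
      w (\<sigma> - \<delta>) x + (\<mu> + \<delta> * (a \<bullet> v t)) *\<^sub>R v y + (\<nu> + \<delta> * (b \<bullet> v t)) *\<^sub>R v z + (\<delta> * (c \<bullet> v t)) *\<^sub>R v r"
    using ne xy xz yz by (simp add: e_def add_ac)
  also have "\<dots> = \<delta> *\<^sub>R ((a \<bullet> v t) *\<^sub>R v y + (b \<bullet> v t) *\<^sub>R v z + (c \<bullet> v t) *\<^sub>R v r) - \<delta> *\<^sub>R v t"
    unfolding wd mn(3) by (simp add: algebra_simps)
  also have "\<dots> = 0" using t by simp
  finally have "surrounds (w (\<sigma> - \<delta>)) {x, y, z, r}"
    by (intro surrounds_if_cone[of _ e x]) (use d c in \<open>auto simp: e_def\<close>)
  then show ?thesis
    by (rule surrounds_before[rotated 3]) (use d xI yI zI ne in auto)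
qed

lemma T_essential:
  assumes "r \<in> T"
  shows "\<not> surrounds v (R - {r})"
proof -
  have "{x, y, z, r} \<subseteq> I" using assms xI yI zI by (simp add: T_def R_def)
  then have "\<not> surrounds v (I - {x, y, z, r})"
    using surrounds_xyz_T[OF assms] by (rule nosplit)
  moreover have "I - {x, y, z, r} = R - {r}" unfolding R_def by blast
  ultimately show ?thesis by simp
qed

lemma plane_vectors_free: "\<not> surrounds v {i \<in> I - J. u \<bullet> v i = 0}"
  by (rule plane_free[OF _ u_nz]) auto

text \<open>Without \<open>T\<close> no index is below the plane, so indices in the plane would have
  to surround the origin, which \<open>plane_free\<close> forbids. Depth 3 thus does not allow
  deleting \<open>T\<close>.\<close>

lemma card_T: "card T \<ge> 3"
proof (rule ccontr)
  assume "\<not> card T \<ge> 3"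
  then have "surrounds v (I - T)"
    by (intro deepD[OF deep3]) (use T_sub R_sub in auto)
  then have "surrounds v {i \<in> I - T. u \<bullet> v i = 0}"
    by (rule surrounds_face) (use finI ux uy uz in \<open>auto simp: T_def R_def\<close>)
  then show False using plane_vectors_free by blast
qed

text \<open>The same argument from above has to delete \<open>x\<close> as well, which accounts for
  the bound 2 instead of 3.\<close>

lemma card_S: "card S \<ge> 2"
proof (rule ccontr)
  assume "\<not> card S \<ge> 2"
  then have "card (insert x S) < 3" using fin card_insert_le_m1[of 3 S x] by (simp add: card_insert_if)
  then have "surrounds v (I - insert x S)"
    by (rule deepD[OF deep3]) (use S_sub R_sub xI in auto)
  then have "surrounds v {i \<in> I - insert x S. (- u) \<bullet> v i = 0}"
    by (rule surrounds_face) (use finI uy uz in \<open>auto simp: S_def R_def\<close>)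
  then show False using plane_vectors_free[of "insert x S"] by simp
qed

end

context oriented_collision
begin

text \<open>A simplex in \<open>R\<close> around the origin uses every index of \<open>T\<close>,
  because each is essential, but not only these, because they lie on one side. Four vertices and
  \<open>card T \<ge> 3\<close> leave exactly one other vertex, \<open>s0\<close>.\<close>

lemma exists_frame:
  obtains C s0 where "card T = 3" "\<forall>p. p + (\<Sum>i\<in>T. (C i \<bullet> p) *\<^sub>R v i) = 0"
    "\<forall>i\<in>T. \<forall>j\<in>T. C i \<bullet> v j = (if i = j then -1 else 0)" "s0 \<in> S" "\<forall>i\<in>T. C i \<bullet> v s0 > 0"
proof -
  obtain K where K: "K \<subseteq> R" "finite K" "card K \<le> DIM(real^3) + 1" "surrounds v K"
    using surrounds_R by (rule surrounds_caratheodory)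
  have "K \<subseteq> I" "card K \<le> 4" using K R_sub by auto
  then obtain c where c1: "\<forall>i\<in>K. c i > (0::real)" and c2: "(\<Sum>i\<in>K. c i *\<^sub>R v i) = 0"
    and c3: "\<forall>d. (\<Sum>i\<in>K. d i *\<^sub>R v i) = 0 \<longrightarrow> (\<exists>\<rho>. \<forall>i\<in>K. d i = \<rho> * c i)" and c4: "card K = 4"
    by (rule circuit4[OF _ K(4)])
  have TK: "T \<subseteq> K"
  proof
    fix r assume r: "r \<in> T"
    show "r \<in> K"
    proof (rule ccontr)
      assume "r \<notin> K"
      then have "surrounds v (R - {r})" using surrounds_mono[OF K(4), of "R - {r}"] K(1) by blast
      then show False using T_essential[OF r] by blast
    qed
  qed
  have su: "(\<Sum>i\<in>K. c i * (u \<bullet> v i)) = 0"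
    using arg_cong[OF c2, of "inner u"] by (simp add: inner_sum_right)
  have "T \<noteq> K"
  proof
    assume "T = K"
    have "(\<Sum>i\<in>K. c i * (- (u \<bullet> v i))) > 0"
    proof (rule sum_pos)
      show "c i * (- (u \<bullet> v i)) > 0" if "i \<in> K" for i
        using c1 that \<open>T = K\<close>[symmetric] by (intro mult_pos_pos) (auto simp: T_def)
    qed (use K(2) c4 in auto)
    then show False using su by (simp add: sum_negf)
  qed
  then have "card T < 4" using psubset_card_mono[OF K(2)] TK c4 by auto
  then have cT: "card T = 3" using card_T by simp
  then have "card (K - T) = 1" using card_Diff_subset[OF fin(2) TK] c4 by simp
  then obtain s0 where s0: "K - T = {s0}" by (rule card_1_singletonE)
  obtain p q r where pqr: "T = {p, q, r}" "p \<noteq> q" "q \<noteq> r" "p \<noteq> r"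
    using cT unfolding card_3_iff by blast
  have Keq: "K = {s0, p, q, r}" and sne: "s0 \<noteq> p" "s0 \<noteq> q" "s0 \<noteq> r" using s0 TK pqr(1) by blast+
  have sumK: "(\<Sum>i\<in>K. d i *\<^sub>R v i) = d s0 *\<^sub>R v s0 + (d p *\<^sub>R v p + (d q *\<^sub>R v q + d r *\<^sub>R v r))" for d
    using sne pqr unfolding Keq by simp
  have sumT: "(\<Sum>i\<in>T. f i) = f p + (f q + f r)" for f :: "'i \<Rightarrow> real^3"
    using pqr by simp
  have indep: "\<alpha> = 0 \<and> \<beta> = 0 \<and> \<gamma> = 0" if rel: "\<alpha> *\<^sub>R v p + \<beta> *\<^sub>R v q + \<gamma> *\<^sub>R v r = 0" for \<alpha> \<beta> \<gamma>
  proof -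
    define d where "d i = (if i = p then \<alpha> else if i = q then \<beta> else if i = r then \<gamma> else 0)" for i
    have "(\<Sum>i\<in>K. d i *\<^sub>R v i) = 0" unfolding sumK using rel sne pqr by (simp add: d_def add_ac)
    then obtain \<rho> where \<rho>: "\<forall>i\<in>K. d i = \<rho> * c i" using c3 by blast
    then have "\<rho> * c s0 = 0" using Keq sne by (auto simp: d_def)
    then have "\<rho> = 0" using c1 Keq by auto
    then have "d p = 0" "d q = 0" "d r = 0" using \<rho> Keq by auto
    then show ?thesis using pqr by (auto simp: d_def)
  qed
  obtain p' q' r' where "\<forall>a. a = (p' \<bullet> a) *\<^sub>R v p + (q' \<bullet> a) *\<^sub>R v q + (r' \<bullet> a) *\<^sub>R v r"
    by (rule basis3_coordinates[OF indep])
  note e = this[rule_format]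
  \<comment> \<open>The dual basis is negated so that points in the cone opposite to
    \<open>T\<close> have positive coordinates.\<close>
  define C where "C i = (if i = p then - p' else if i = q then - q' else - r')" for i
  have C: "C p = - p'" "C q = - q'" "C r = - r'" using pqr by (auto simp: C_def)
  have expand: "a + (\<Sum>i\<in>T. (C i \<bullet> a) *\<^sub>R v i) = 0" for a
    unfolding sumT C using e[of a] by (simp add: algebra_simps)
  have dual: "C i \<bullet> v j = (if i = j then -1 else 0)" if "i \<in> T" "j \<in> T" for i j
  proof -
    define \<epsilon> where "\<epsilon> k = (if k = j then (1::real) else 0)" for k
    have vj: "v j = \<epsilon> p *\<^sub>R v p + \<epsilon> q *\<^sub>R v q + \<epsilon> r *\<^sub>R v r"
      using that(2) pqr by (auto simp: \<epsilon>_def)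
    have "(p' \<bullet> v j - \<epsilon> p) *\<^sub>R v p + (q' \<bullet> v j - \<epsilon> q) *\<^sub>R v q + (r' \<bullet> v j - \<epsilon> r) *\<^sub>R v r =
        ((p' \<bullet> v j) *\<^sub>R v p + (q' \<bullet> v j) *\<^sub>R v q + (r' \<bullet> v j) *\<^sub>R v r) - (\<epsilon> p *\<^sub>R v p + \<epsilon> q *\<^sub>R v q + \<epsilon> r *\<^sub>R v r)"
      by (simp add: algebra_simps)
    also have "\<dots> = 0" using e[of "v j"] vj by simp
    finally have "p' \<bullet> v j - \<epsilon> p = 0 \<and> q' \<bullet> v j - \<epsilon> q = 0 \<and> r' \<bullet> v j - \<epsilon> r = 0" by (rule indep)
    then have "C i \<bullet> v j = - \<epsilon> i" using that(1) C pqr(1) by auto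
    then show ?thesis by (simp add: \<epsilon>_def)
  qed
  define d where "d i = (if i = s0 then 1 else C i \<bullet> v s0)" for i
  have "(\<Sum>i\<in>K. d i *\<^sub>R v i) = v s0 + (\<Sum>i\<in>T. (C i \<bullet> v s0) *\<^sub>R v i)"
    unfolding sumK sumT using sne by (simp add: d_def)
  then have "(\<Sum>i\<in>K. d i *\<^sub>R v i) = 0" using expand by simp
  then obtain \<rho> where \<rho>: "\<forall>i\<in>K. d i = \<rho> * c i" using c3 by blast
  have "d s0 = \<rho> * c s0" using \<rho> Keq by simp
  then have "\<rho> * c s0 > 0" by (simp add: d_def)
  moreover have "c s0 > 0" using c1 Keq by simp
  ultimately have rpos: "\<rho> > 0" by (simp add: zero_less_mult_iff)
  have Cs0: "C i \<bullet> v s0 > 0" if "i \<in> T" for i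
  proof -
    have "d i = \<rho> * c i" "c i > 0" using \<rho> c1 that TK by auto
    moreover have "i \<noteq> s0" using that s0 by blast
    ultimately show ?thesis using rpos by (simp add: d_def)
  qed
  have "u \<bullet> v s0 + (\<Sum>i\<in>T. (C i \<bullet> v s0) * (u \<bullet> v i)) = 0"
    using arg_cong[OF expand[of "v s0"], of "inner u"] by (simp add: inner_add_right inner_sum_right)
  moreover have "(\<Sum>i\<in>T. (C i \<bullet> v s0) * (- (u \<bullet> v i))) > 0"
  proof (rule sum_pos)
    show "(C i \<bullet> v s0) * (- (u \<bullet> v i)) > 0" if "i \<in> T" for i
      using Cs0[OF that] that by (intro mult_pos_pos) (auto simp: T_def)
  qed (use fin cT in auto)
  ultimately have "u \<bullet> v s0 > 0" by (simp add: sum_negf)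
  then have "s0 \<in> S" using s0 K(1) by (auto simp: S_def)
  then show ?thesis using that[OF cT, of C s0] expand dual Cs0 by blast
qed

end

section \<open>Coordinates with respect to the three points below the plane\<close>

locale framed_collision = oriented_collision I v x t \<sigma> w y z u
  for I :: "'i set" and v :: "'i \<Rightarrow> real^3" and x t \<sigma> w y z u +
  fixes C :: "'i \<Rightarrow> real^3" and s0 :: 'i
  assumes cT: "card T = 3" and expand: "\<And>p. p + (\<Sum>i\<in>T. (C i \<bullet> p) *\<^sub>R v i) = 0"
    and dual: "\<And>i j. i \<in> T \<Longrightarrow> j \<in> T \<Longrightarrow> C i \<bullet> v j = (if i = j then -1 else 0)"
    and s0: "s0 \<in> S" and C_s0: "\<And>i. i \<in> T \<Longrightarrow> C i \<bullet> v s0 > 0"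
begin

lemma u_expand: "u \<bullet> p = (\<Sum>i\<in>T. (C i \<bullet> p) * (- (u \<bullet> v i)))"
proof -
  have "u \<bullet> p + (\<Sum>i\<in>T. (C i \<bullet> p) * (u \<bullet> v i)) = 0"
    using arg_cong[OF expand[of p], of "inner u"] by (simp add: inner_add_right inner_sum_right)
  then show ?thesis by (simp add: sum_negf)
qed

lemma uT: "i \<in> T \<Longrightarrow> u \<bullet> v i < 0"
  by (simp add: T_def)

lemma T_ne: "T \<noteq> {}"
  using cT by auto

lemma C_rest_pos:
  assumes r: "r \<in> R - T" and k: "k \<in> T"
  shows "C k \<bullet> v r > 0"
proof (rule ccontr)
  assume neg: "\<not> C k \<bullet> v r > 0"
  \<comment> \<open>Move \<open>v r\<close> towards \<open>v s0\<close> until its last nonpositive coordinate vanishes: the functional that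
    separates the rest from the corresponding point of \<open>T\<close> has contradictory signs there.\<close>
  define f where "f i = (C i \<bullet> v r) / (C i \<bullet> v s0)" for i
  define \<rho> where "\<rho> = - Min (f ` T)"
  have "Min (f ` T) \<in> f ` T" using fin(2) T_ne by (intro Min_in) auto
  then obtain i where i: "i \<in> T" "f i = - \<rho>" unfolding \<rho>_def by force
  have le: "- \<rho> \<le> f j" if "j \<in> T" for j
    unfolding \<rho>_def using fin(2) that by simp
  have "f k \<le> 0" using neg C_s0[OF k] by (simp add: f_def divide_nonpos_pos)
  then have rho: "\<rho> \<ge> 0" using le[OF k] by simp
  define p where "p = v r + \<rho> *\<^sub>R v s0"
  have Cp: "C j \<bullet> p \<ge> 0" if "j \<in> T" for j
    using le[OF that] C_s0[OF that] by (simp add: p_def f_def inner_add_right field_simps)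
  have Cip: "C i \<bullet> p = 0"
    using i(2) C_s0[OF i(1)] by (simp add: p_def f_def inner_add_right field_simps)
  obtain a where a: "\<And>j. j \<in> R - {i} \<Longrightarrow> a \<bullet> v j > 0"
    by (rule not_surroundsE[OF T_essential[OF i(1)]]) (use fin in auto)
  have "s0 \<noteq> i" "s0 \<in> R" using s0 uT[OF i(1)] by (auto simp: S_def)
  then have "a \<bullet> v s0 > 0" using a by blast
  moreover have "a \<bullet> v r > 0" using a r i(1) by blast
  ultimately have "a \<bullet> p > 0" using rho by (simp add: p_def inner_add_right add_pos_nonneg)
  moreover have "a \<bullet> p + (\<Sum>j\<in>T. (C j \<bullet> p) * (a \<bullet> v j)) = 0"
    using arg_cong[OF expand[of p], of "inner a"] by (simp add: inner_add_right inner_sum_right)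
  moreover have "(\<Sum>j\<in>T. (C j \<bullet> p) * (a \<bullet> v j)) \<ge> 0"
  proof (rule sum_nonneg)
    fix j assume j: "j \<in> T"
    show "(C j \<bullet> p) * (a \<bullet> v j) \<ge> 0"
    proof (cases "j = i")
      case True
      then show ?thesis using Cip by simp
    next
      case False
      then have "a \<bullet> v j > 0" using a j T_sub by blast
      then show ?thesis using Cp[OF j] by simp
    qed
  qed
  ultimately show False by linarith
qed

text \<open>Positive coordinates place a point strictly above the plane, which excludes further
  points in the plane.\<close>

lemma R_eq: "R = T \<union> S"
proof -
  have "r \<in> S" if r: "r \<in> R - T" for r
  proof -
    have "u \<bullet> v r > 0"
      unfolding u_expand[of "v r"]
    proof (rule sum_pos)
      show "(C i \<bullet> v r) * (- (u \<bullet> v i)) > 0" if "i \<in> T" for i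
        using C_rest_pos[OF r that] uT[OF that] by (intro mult_pos_pos) auto
    qed (use fin(2) T_ne in auto)
    then show ?thesis using r by (simp add: S_def)
  qed
  then show ?thesis using T_sub S_sub by blast
qed

lemma C_S_pos: "s \<in> S \<Longrightarrow> i \<in> T \<Longrightarrow> C i \<bullet> v s > 0"
  using C_rest_pos[of s i] S_sub uT by (force simp: S_def)

text \<open>Delete \<open>i\<close> and \<open>j\<close>. If both other members of the triple had
  positive \<open>i\<close>-th coordinate, this coordinate would be nonnegative on everything left
  and zero at most on \<open>T - {i}\<close>. Two original vectors would then surround the
  origin.\<close>

lemma two_nonpos:
  assumes i: "i \<in> T" and j: "j \<in> {x, y, z}"
  shows "\<exists>k\<in>{x, y, z} - {j}. C i \<bullet> w \<sigma> k \<le> 0"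
proof (rule ccontr)
  assume neg: "\<not> ?thesis"
  have notx: "l \<noteq> x" if "l \<in> R" for l using that by (auto simp: R_def)
  have "surrounds (w \<sigma>) (I - {i, j})"
    by (rule deepD[OF deep3_limit]) (use i j T_sub R_sub xI yI zI in \<open>auto simp: card_insert_if\<close>)
  then have f: "surrounds (w \<sigma>) {l \<in> I - {i, j}. C i \<bullet> w \<sigma> l = 0}"
  proof (rule surrounds_face)
    fix l assume l: "l \<in> I - {i, j}"
    show "0 \<le> C i \<bullet> w \<sigma> l"
    proof (cases "l \<in> {x, y, z}")
      case True
      then have "l \<in> {x, y, z} - {j}" using l by blast
      then show ?thesis using neg by (meson linear)
    next
      case False
      then have "l \<in> R" using l by (simp add: R_def)
      then show ?thesis
        using R_eq C_S_pos[OF _ i, of l] dual[OF i, of l] l notx by (auto simp: less_imp_le)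
    qed
  qed (use finI in auto)
  have "{l \<in> I - {i, j}. C i \<bullet> w \<sigma> l = 0} \<subseteq> T - {i}"
  proof
    fix l assume l: "l \<in> {l \<in> I - {i, j}. C i \<bullet> w \<sigma> l = 0}"
    then have "l \<notin> {x, y, z}" using neg by force
    then have lR: "l \<in> R" using l by (simp add: R_def)
    moreover have "l \<notin> S" using C_S_pos[OF _ i, of l] l notx[OF lR] by auto
    ultimately show "l \<in> T - {i}" using R_eq l by blast
  qed
  then have "surrounds (w \<sigma>) (T - {i})" using f surrounds_mono by blast
  moreover have "x \<notin> T - {i}" using notx T_sub by blast
  ultimately have "surrounds v (T - {i})" by (simp add: surrounds_w_other)
  then show False using no_small[of "T - {i}"] i cT fin(2) T_sub R_sub by auto
qed

lemma row_sum:
  obtains \<mu> \<nu> where "\<mu> > 0" "\<nu> > 0" "\<And>a. a \<bullet> w \<sigma> x + \<mu> * (a \<bullet> w \<sigma> y) + \<nu> * (a \<bullet> w \<sigma> z) = 0"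
proof -
  obtain \<mu> \<nu> where mn: "\<mu> > 0" "\<nu> > 0" "w \<sigma> x = - (\<mu> *\<^sub>R v y + \<nu> *\<^sub>R v z)" by (rule wx_eq)
  have "a \<bullet> w \<sigma> x + \<mu> * (a \<bullet> w \<sigma> y) + \<nu> * (a \<bullet> w \<sigma> z) = 0" for a
    unfolding mn(3) using xy xz by (simp add: inner_diff_right)
  then show ?thesis using that mn by blast
qed

lemma unique_positive:
  assumes i: "i \<in> T" and jk: "j \<in> {x, y, z}" "k \<in> {x, y, z}" "C i \<bullet> w \<sigma> j > 0" "C i \<bullet> w \<sigma> k > 0"
  shows "j = k"
proof (rule ccontr)
  assume ne: "j \<noteq> k"
  then obtain l where l: "l \<in> {x, y, z}" "{x, y, z} - {l} = {j, k}"
    using jk xy yz xz by auto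
  then show False using two_nonpos[OF i l(1)] jk by auto
qed

text \<open>\<open>u\<close> is negative on \<open>T\<close> and vanishes on the triple, so a column
  without positive entries would be zero.\<close>

lemma exists_positive_column:
  assumes j: "j \<in> {x, y, z}"
  shows "\<exists>i\<in>T. C i \<bullet> w \<sigma> j > 0"
proof (rule ccontr)
  assume neg: "\<not> ?thesis"
  have "u \<bullet> w \<sigma> j = 0" using j uwx uy uz xy xz by auto
  then have "(\<Sum>i\<in>T. (C i \<bullet> w \<sigma> j) * (u \<bullet> v i)) = 0" using u_expand[of "w \<sigma> j"] by (simp add: sum_negf)
  moreover have nn: "\<forall>i\<in>T. (C i \<bullet> w \<sigma> j) * (u \<bullet> v i) \<ge> 0"
    using neg uT by (meson mult_nonpos_nonpos not_le less_imp_le)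
  ultimately have "\<forall>i\<in>T. (C i \<bullet> w \<sigma> j) * (u \<bullet> v i) = 0"
    using sum_nonneg_eq_0_iff[OF fin(2), of "\<lambda>i. (C i \<bullet> w \<sigma> j) * (u \<bullet> v i)"] by blast
  then have "\<forall>i\<in>T. C i \<bullet> w \<sigma> j = 0" using uT by fastforce
  then have "w \<sigma> j = 0" using expand[of "w \<sigma> j"] by simp
  then show False using no_pair[of "{j}"] j xI yI zI by (auto simp: surrounds_singleton)
qed

end

lemma surrounds_if_cone_zero:
  assumes "cone_zero (w a) (w b) (w c) (w d)" "a \<noteq> b" "a \<noteq> c" "a \<noteq> d" "b \<noteq> c" "b \<noteq> d" "c \<noteq> d"
  shows "surrounds w {a, b, c, d}"
proof -
  obtain p q r where pqr: "p \<ge> 0" "q \<ge> 0" "r \<ge> 0" "w a + p *\<^sub>R w b + q *\<^sub>R w c + r *\<^sub>R w d = 0"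
    using assms(1) unfolding cone_zero_def by blast
  define e where "e i = (if i = a then 1 else if i = b then p else if i = c then q else r)" for i
  have "(\<Sum>i\<in>{a, b, c, d}. e i *\<^sub>R w i) = w a + p *\<^sub>R w b + q *\<^sub>R w c + r *\<^sub>R w d"
    using assms(2-) by (simp add: e_def add_ac)
  then show ?thesis
    by (intro surrounds_if_cone[of _ e a]) (use pqr in \<open>auto simp: e_def\<close>)
qed

context framed_collision
begin

text \<open>In the matrix with rows \<open>T\<close> and columns \<open>x\<close>, \<open>y\<close>,
  \<open>z\<close>, each row has at most one positive entry and each column at least one. With three
  rows and three columns the positive entries form a bijection.\<close>

lemma matching:
  obtains g where "\<And>i. i \<in> {x, y, z} \<Longrightarrow> g i \<in> T" "inj_on g {x, y, z}" "T = g ` {x, y, z}"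
    "\<And>i. i \<in> {x, y, z} \<Longrightarrow> C (g i) \<bullet> w \<sigma> i > 0"
    "\<And>i j. i \<in> {x, y, z} \<Longrightarrow> j \<in> {x, y, z} \<Longrightarrow> i \<noteq> j \<Longrightarrow> C (g i) \<bullet> w \<sigma> j \<le> 0"
proof -
  have "\<forall>j\<in>{x, y, z}. \<exists>i. i \<in> T \<and> C i \<bullet> w \<sigma> j > 0" using exists_positive_column by blast
  from bchoice[OF this] obtain g where g: "\<forall>j\<in>{x, y, z}. g j \<in> T \<and> C (g j) \<bullet> w \<sigma> j > 0" by blast
  have off: "C (g i) \<bullet> w \<sigma> j \<le> 0" if "i \<in> {x, y, z}" "j \<in> {x, y, z}" "i \<noteq> j" for i j
    using unique_positive[of "g i" i j] g that by (meson not_le)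
  have inj: "inj_on g {x, y, z}"
  proof (rule inj_onI)
    fix i j assume ij: "i \<in> {x, y, z}" "j \<in> {x, y, z}" "g i = g j"
    then have "C (g i) \<bullet> w \<sigma> j > 0" using bspec[OF g ij(2)] by metis
    then show "i = j" using off[OF ij(1,2)] by force
  qed
  have "g ` {x, y, z} = T"
  proof (rule card_seteq)
    have "card (g ` {x, y, z}) = 3" unfolding card_image[OF inj] using xy yz xz by simp
    then show "card T \<le> card (g ` {x, y, z})" using cT by simp
  qed (use g fin in auto)
  then show ?thesis using that[of g] g off inj by blast
qed

lemma contradiction: False
proof -
  define X where "X = {x, y, z}"
  obtain g where "\<And>i. i \<in> {x, y, z} \<Longrightarrow> g i \<in> T" "inj_on g {x, y, z}" "T = g ` {x, y, z}"
    "\<And>i. i \<in> {x, y, z} \<Longrightarrow> C (g i) \<bullet> w \<sigma> i > 0"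
    "\<And>i j. i \<in> {x, y, z} \<Longrightarrow> j \<in> {x, y, z} \<Longrightarrow> i \<noteq> j \<Longrightarrow> C (g i) \<bullet> w \<sigma> j \<le> 0"
    using matching by blast
  note g = this[folded X_def]
  have finX: "finite X" by (simp add: X_def)
  have "\<not> card S \<le> Suc 0" using card_S by simp
  then obtain s s' where s: "s \<in> S" "s' \<in> S" "s \<noteq> s'"
    unfolding card_le_Suc0_iff_eq[OF fin(3)] by blast
  define a where "a i = C (g i)" for i
  \<comment> \<open>The collision is \<open>\<delta> = 0\<close>. The strict sign conditions are
    proved there and carried to a small positive \<open>\<delta>\<close>, because only surrounding
    sets before \<open>\<sigma>\<close> transfer back to \<open>v\<close>.\<close>
  define M where "M \<delta> i j = a i \<bullet> w (\<sigma> - \<delta>) j" for \<delta> i j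
  have M0: "M 0 i j = C (g i) \<bullet> w \<sigma> j" for i j by (simp add: M_def a_def)
  have perm: "i \<in> X" "j \<in> X" "k \<in> X" "i \<noteq> j" "j \<noteq> k" "i \<noteq> k" if "{i, j, k} = X" for i j k
  proof -
    show "i \<in> X" "j \<in> X" "k \<in> X" using that by blast+
    have "card {i, j, k} = 3" unfolding that X_def using xy yz xz by simp
    then show "i \<noteq> j" "j \<noteq> k" "i \<noteq> k" by (auto simp: card_insert_if split: if_splits)
  qed
  have diag: "M 0 i i > 0" if "i \<in> X" for i using g(4) that by (simp add: M0)
  have off: "M 0 i j \<le> 0" if "i \<in> X" "j \<in> X" "i \<noteq> j" for i j using g(5) that by (simp add: M0)
  have as: "a i \<bullet> v r > 0" if "i \<in> X" "r \<in> S" for i r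
    using C_S_pos[OF that(2) g(1)[OF that(1)]] by (simp add: a_def)
  obtain \<mu> \<nu> where mn: "\<mu> > 0" "\<nu> > 0" "\<And>b. b \<bullet> w \<sigma> x + \<mu> * (b \<bullet> w \<sigma> y) + \<nu> * (b \<bullet> w \<sigma> z) = 0"
    using row_sum by blast
  \<comment> \<open>The relation of the triple gives positive weights \<open>m\<close> that
    annihilate each row of \<open>M 0\<close>; below, \<open>u\<close>, which vanishes on the
    triple, gives positive weights \<open>\<omega>\<close> that annihilate each column.\<close>
  define m where "m j = (if j = x then 1 else if j = y then \<mu> else \<nu>)" for j
  have m: "m j > 0" for j using mn by (simp add: m_def)
  have row: "m i * M 0 i i + m j * M 0 i j + m k * M 0 i k = 0" if ijk: "{i, j, k} = X" for i j k
  proof -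
    have "(\<Sum>l\<in>{i, j, k}. m l * M 0 i l) = (\<Sum>l\<in>{x, y, z}. m l * M 0 i l)" using ijk X_def by simp
    also have "\<dots> = 0" unfolding sum_xyz using mn(3)[of "C (g i)"] xy xz yz by (simp add: m_def M0)
    finally show ?thesis using perm[OF ijk] by (simp add: add_ac)
  qed
  define \<omega> where "\<omega> l = - (u \<bullet> v (g l))" for l
  have om: "\<omega> l > 0" if "l \<in> X" for l using uT[OF g(1)[OF that]] by (simp add: \<omega>_def)
  have uw: "u \<bullet> w \<sigma> l = 0" if "l \<in> X" for l using that uwx uy uz xy xz by (auto simp: X_def)
  have column: "\<omega> i * M 0 i l + \<omega> j * M 0 j l + \<omega> k * M 0 k l = 0" if ijk: "{i, j, k} = X" and l: "l \<in> X" for i j k l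
  proof -
    have "u \<bullet> w \<sigma> l = (\<Sum>n\<in>X. (C (g n) \<bullet> w \<sigma> l) * (- (u \<bullet> v (g n))))"
      unfolding u_expand[of "w \<sigma> l"] g(3) using g(2) by (rule sum.reindex_cong) auto
    then have "(\<Sum>n\<in>{i, j, k}. \<omega> n * M 0 n l) = 0"
      unfolding ijk using uw[OF l] by (simp add: \<omega>_def M0 mult_ac)
    then show ?thesis using perm[OF ijk] by (simp add: add_ac)
  qed
  have col: "M 0 j i < 0 \<or> M 0 k i < 0" if ijk: "{i, j, k} = X" for i j k
  proof (rule ccontr)
    note p = perm[OF ijk]
    assume "\<not> ?thesis"
    then have "M 0 j i = 0" "M 0 k i = 0" using off[of j i] off[of k i] p by auto
    then have "\<omega> i * M 0 i i = 0" using column[OF ijk p(1)] by simp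
    then show False using om[OF p(1)] diag[OF p(1)] by simp
  qed
  \<comment> \<open>The only delicate case is a zero at \<open>(i, k)\<close>: then column
    \<open>k\<close> needs a negative entry in row \<open>j\<close>, and row \<open>i\<close> a
    negative entry in column \<open>j\<close>.\<close>
  have minor: "M 0 i j * M 0 j k - M 0 i k * M 0 j j > 0" if ijk: "{i, j, k} = X" for i j k
  proof -
    note p = perm[OF ijk]
    have n: "M 0 i j \<le> 0" "M 0 j k \<le> 0" "M 0 i k \<le> 0" "M 0 j j > 0" using off diag p by auto
    show ?thesis
    proof (cases "M 0 i k < 0")
      case True
      then have "M 0 i k * M 0 j j < 0" using n(4) by (rule mult_neg_pos)
      moreover have "M 0 i j * M 0 j k \<ge> 0" using n(1,2) by (rule mult_nonpos_nonpos)
      ultimately show ?thesis by linarith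
    next
      case False
      then have z: "M 0 i k = 0" using n(3) by simp
      have "{k, i, j} = X" using ijk by blast
      then have "M 0 j k < 0" using col[of k i j] z by simp
      moreover have "M 0 i j < 0"
      proof (rule ccontr)
        assume "\<not> M 0 i j < 0"
        then have "M 0 i j = 0" using n(1) by simp
        then have "m i * M 0 i i = 0" using row[OF ijk] z by simp
        then show False using m[of i] diag[OF p(1)] by simp
      qed
      ultimately show ?thesis using z by (simp add: mult_neg_neg)
    qed
  qed
  have d: "(a i \<bullet> v r) * M 0 j j - M 0 i j * (a j \<bullet> v r) > 0" if "i \<in> X" "j \<in> X" "i \<noteq> j" "r \<in> S" for i j r
  proof -
    have "(a i \<bullet> v r) * M 0 j j > 0" using as diag that by (intro mult_pos_pos)
    moreover have "M 0 i j * (a j \<bullet> v r) \<le> 0" using off[OF that(1-3)] less_imp_le[OF as[OF that(2,4)]] by (rule mult_nonpos_nonneg)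
    ultimately show ?thesis by linarith
  qed
  have lim: "((\<lambda>\<delta>. M \<delta> i j) \<longlongrightarrow> M 0 i j) (nhds 0)" for i j
  proof -
    define e where "e = (if j = x then a i \<bullet> v t else 0)"
    have "((\<lambda>\<delta>. a i \<bullet> w \<sigma> j - \<delta> * e) \<longlongrightarrow> a i \<bullet> w \<sigma> j - 0 * e) (nhds 0)"
      by (intro tendsto_intros filterlim_ident)
    moreover have "(\<lambda>\<delta>. M \<delta> i j) = (\<lambda>\<delta>. a i \<bullet> w \<sigma> j - \<delta> * e)"
      by (rule ext) (simp add: M_def e_def w_x inner_add_right algebra_simps)
    moreover have "M 0 i j = a i \<bullet> w \<sigma> j - 0 * e" by (simp add: M_def)
    ultimately show ?thesis by (simp only:)
  qed
  define G where "G \<delta> i j k \<longleftrightarrow> M \<delta> i i > 0 \<and> (M \<delta> j i < 0 \<or> M \<delta> k i < 0) \<and>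
    M \<delta> i j * M \<delta> j k - M \<delta> i k * M \<delta> j j > 0 \<and>
    (a i \<bullet> v s) * M \<delta> j j - M \<delta> i j * (a j \<bullet> v s) > 0 \<and>
    (a i \<bullet> v s') * M \<delta> j j - M \<delta> i j * (a j \<bullet> v s') > 0" for \<delta> i j k
  have "\<forall>\<^sub>F \<delta> in nhds 0. {i, j, k} = X \<longrightarrow> G \<delta> i j k" for i j k
  proof (cases "{i, j, k} = X")
    case ijk: True
    note p = perm[OF ijk]
    have 1: "\<forall>\<^sub>F \<delta> in nhds 0. M \<delta> i i > 0"
      by (rule order_tendstoD(1)[OF lim diag[OF p(1)]])
    have 2: "\<forall>\<^sub>F \<delta> in nhds 0. M \<delta> j i < 0 \<or> M \<delta> k i < 0"
      using col[OF ijk]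
    proof
      assume "M 0 j i < 0"
      then have "\<forall>\<^sub>F \<delta> in nhds 0. M \<delta> j i < 0" by (rule order_tendstoD(2)[OF lim])
      then show ?thesis by (rule eventually_mono) simp
    next
      assume "M 0 k i < 0"
      then have "\<forall>\<^sub>F \<delta> in nhds 0. M \<delta> k i < 0" by (rule order_tendstoD(2)[OF lim])
      then show ?thesis by (rule eventually_mono) simp
    qed
    have 3: "\<forall>\<^sub>F \<delta> in nhds 0. M \<delta> i j * M \<delta> j k - M \<delta> i k * M \<delta> j j > 0"
      by (rule order_tendstoD(1)[OF _ minor[OF ijk]]) (intro tendsto_intros lim)
    have 4: "\<forall>\<^sub>F \<delta> in nhds 0. (a i \<bullet> v r) * M \<delta> j j - M \<delta> i j * (a j \<bullet> v r) > 0" if "r \<in> S" for r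
      by (rule order_tendstoD(1)[OF _ d[OF p(1,2,4) that]]) (intro tendsto_intros lim)
    show ?thesis
      using 1 2 3 4[OF s(1)] 4[OF s(2)] by eventually_elim (simp add: G_def)
  qed simp
  then have "\<forall>\<^sub>F \<delta> in nhds 0. \<forall>i\<in>X. \<forall>j\<in>X. \<forall>k\<in>X. {i, j, k} = X \<longrightarrow> G \<delta> i j k"
    by (intro eventually_ball_finite finX ballI)
  then obtain \<delta> where \<delta>: "0 < \<delta>" "\<delta> < \<sigma>" and GX: "\<forall>i\<in>X. \<forall>j\<in>X. \<forall>k\<in>X. {i, j, k} = X \<longrightarrow> G \<delta> i j k"
    using \<sigma> by (rule eventually_small_positive)
  have G: "G \<delta> i j k" if "{i, j, k} = X" for i j k
    using GX perm(1-3)[OF that] that by blast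
  define \<tau> where "\<tau> = \<sigma> - \<delta>"
  have \<tau>: "0 \<le> \<tau>" "\<tau> < \<sigma>" using \<delta> by (auto simp: \<tau>_def)
  have M\<delta>: "M \<delta> i j = a i \<bullet> w \<tau> j" for i j by (simp add: M_def \<tau>_def)
  have third: "\<exists>k. {i, j, k} = X" if "i \<in> X" "j \<in> X" "i \<noteq> j" for i j
    using that by (auto simp: X_def)
  obtain i j k p q where ijk: "{i, j, k} = {x, y, z}" and pq: "{p, q} = {v s, v s'}"
    and cones: "cone_zero p (v (g i)) (v (g j)) (w \<tau> i)" "cone_zero q (v (g k)) (w \<tau> k) (w \<tau> j)"
  proof (rule two_cones_at_collision[where x = x and y = y and z = z and a = a and t = "\<lambda>i. v (g i)"
        and \<xi> = "w \<tau>" and u = u and s = "v s" and s' = "v s'"])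
    show "x \<noteq> y" "y \<noteq> z" "x \<noteq> z" by (fact xy yz xz)+
    show "p + ((a x \<bullet> p) *\<^sub>R v (g x) + (a y \<bullet> p) *\<^sub>R v (g y) + (a z \<bullet> p) *\<^sub>R v (g z)) = 0" for p
    proof -
      have "(\<Sum>l\<in>T. (C l \<bullet> p) *\<^sub>R v l) = (\<Sum>n\<in>{x, y, z}. (a n \<bullet> p) *\<^sub>R v (g n))"
        unfolding g(3) using g(2) by (intro sum.reindex_cong[of g]) (auto simp: a_def X_def)
      then show ?thesis using expand[of p] unfolding sum_xyz by simp
    qed
    show "u \<bullet> v (g i) < 0" if "i \<in> {x, y, z}" for i using uT g(1) that by (simp add: X_def)
    show "u \<bullet> w \<tau> i \<ge> 0" if "i \<in> {x, y, z}" for i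
      using that uw_before[of \<tau>] \<tau> uy uz xy xz by auto
    show "u \<bullet> v s > 0" "u \<bullet> v s' > 0" using s by (auto simp: S_def)
    show "a i \<bullet> v s > 0" "a i \<bullet> v s' > 0" if "i \<in> {x, y, z}" for i using as s that by (auto simp: X_def)
    show "a i \<bullet> w \<tau> i > 0" if i: "i \<in> {x, y, z}" for i
    proof -
      obtain j where j: "j \<in> X" "i \<noteq> j" using xy i unfolding X_def by (metis insertCI)
      then obtain k where "{i, j, k} = X" using third[of i j] i by (auto simp: X_def)
      then show ?thesis using G by (simp add: G_def M\<delta>)
    qed
    show "a j \<bullet> w \<tau> i < 0 \<or> a k \<bullet> w \<tau> i < 0" if "{i, j, k} = {x, y, z}" for i j k
      using G[of i j k] that by (simp add: G_def M\<delta> X_def)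
    show "(a i \<bullet> w \<tau> j) * (a j \<bullet> w \<tau> k) - (a i \<bullet> w \<tau> k) * (a j \<bullet> w \<tau> j) > 0" if "{i, j, k} = {x, y, z}" for i j k
      using G[of i j k] that by (simp add: G_def M\<delta> X_def)
    show "(a i \<bullet> r) * (a j \<bullet> w \<tau> j) - (a i \<bullet> w \<tau> j) * (a j \<bullet> r) > 0"
      if ij: "i \<in> {x, y, z}" "j \<in> {x, y, z}" "i \<noteq> j" and r: "r \<in> {v s, v s'}" for i j r
    proof -
      obtain k where "{i, j, k} = X" using third[of i j] ij by (auto simp: X_def)
      then have "G \<delta> i j k" by (rule G)
      then show ?thesis using r by (auto simp: G_def M\<delta>)
    qed
  qed (rule that)
  note p = perm[OF ijk[folded X_def]]
  obtain r r' where r: "r \<in> S" "r' \<in> S" "r \<noteq> r'" "p = v r" "q = v r'"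
    using pq s by (auto simp: doubleton_eq_iff)
  have wS: "w \<tau> l = v l" if "l \<in> R" for l using that by (auto simp: R_def)
  have gT: "g l \<in> T" "g l \<in> R" "g l \<notin> X" if "l \<in> X" for l
    using g(1)[OF that] T_sub by (auto simp: R_def X_def)
  have SR: "l \<in> R" "l \<notin> X" "l \<notin> T" if "l \<in> S" for l
    using that S_sub by (auto simp: S_def T_def R_def X_def)
  have ginj: "g l \<noteq> g n" if "l \<in> X" "n \<in> X" "l \<noteq> n" for l n
    using g(2) that by (auto dest: inj_onD)
  have Sg: "l \<noteq> g n" and SX: "l \<noteq> n" if "l \<in> S" "n \<in> X" for l n
    using SR[OF that(1)] gT[OF that(2)] that(2) by blast+
  have gX: "g l \<noteq> n" if "l \<in> X" "n \<in> X" for l n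
    using gT[OF that(1)] that(2) by blast
  have "cone_zero (w \<tau> r) (w \<tau> (g i)) (w \<tau> (g j)) (w \<tau> i)"
    using cones(1) r wS SR gT p by simp
  then have B: "surrounds (w \<tau>) {r, g i, g j, i}"
    by (rule surrounds_if_cone_zero) (fact Sg[OF r(1) p(1)] Sg[OF r(1) p(2)] SX[OF r(1) p(1)]
        ginj[OF p(1,2,4)] gX[OF p(1,1)] gX[OF p(2,1)])+
  have "cone_zero (w \<tau> r') (w \<tau> (g k)) (w \<tau> k) (w \<tau> j)"
    using cones(2) r wS SR gT p by simp
  then have A: "surrounds (w \<tau>) {r', g k, k, j}"
    by (rule surrounds_if_cone_zero) (fact Sg[OF r(2) p(3)] SX[OF r(2) p(3)] SX[OF r(2) p(2)]
        gX[OF p(3,3)] gX[OF p(3,2)] p(5)[symmetric])+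
  have XI: "X \<subseteq> I" using xI yI zI by (simp add: X_def)
  have BI: "{r, g i, g j, i} \<subseteq> I" and AI: "{r', g k, k, j} \<subseteq> I"
    using r SR gT p XI R_sub by blast+
  have "{r', g k, k, j} \<subseteq> I - {r, g i, g j, i}"
  proof -
    have "r' \<notin> {r, g i, g j, i}" "g k \<notin> {r, g i, g j, i}" "k \<notin> {r, g i, g j, i}" "j \<notin> {r, g i, g j, i}"
      using r(3) Sg[OF r(2) p(1)] Sg[OF r(2) p(2)] SX[OF r(2) p(1)]
        Sg[OF r(1) p(3)] ginj[OF p(3,1)] ginj[OF p(3,2)] gX[OF p(3,1)]
        SX[OF r(1) p(3)] gX[OF p(1,3)] gX[OF p(2,3)] SX[OF r(1) p(2)] gX[OF p(1,2)] gX[OF p(2,2)] p(4-6)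
      by auto
    then show ?thesis using AI unfolding insert_subset Diff_iff by simp
  qed
  \<comment> \<open>Both quadruples surround the origin at a time before \<open>\<sigma>\<close>,
    hence in the original family too, against \<open>nosplit\<close>.\<close>
  with surrounds_before[OF AI \<tau> A] have "surrounds v (I - {r, g i, g j, i})"
    by (rule surrounds_mono)
  then show False using nosplit[OF BI surrounds_before[OF BI \<tau> B]] by contradiction
qed

end

lemma deep3_split:
  fixes v :: "'i \<Rightarrow> real^3"
  assumes "finite I" "deep 3 I v"
  obtains A where "A \<subseteq> I" "surrounds v A" "surrounds v (I - A)"
proof (rule ccontr)
  assume neg: "\<not> thesis"
  have "unsplittable I v"
    by unfold_locales (use assms neg that in blast)+
  then interpret unsplittable I v .
  obtain x t \<sigma> where "collision I v x t \<sigma>" using exists_collision by blast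
  then interpret collision I v x t \<sigma> "\<lambda>\<tau>. v(x := v x + \<tau> *\<^sub>R v t)" .
  obtain y z where "y \<in> I" "z \<in> I" "x \<noteq> y" "y \<noteq> z" "x \<noteq> z"
    "surrounds (v(x := v x + \<sigma> *\<^sub>R v t)) {x, y, z}"
    by (rule collision_triple)
  then interpret coplanar_collision I v x t \<sigma> "\<lambda>\<tau>. v(x := v x + \<tau> *\<^sub>R v t)" y z
    by unfold_locales
  obtain u where "u \<bullet> v y = 0" "u \<bullet> v z = 0" "u \<bullet> v x > 0" by (rule exists_normal)
  then interpret oriented_collision I v x t \<sigma> "\<lambda>\<tau>. v(x := v x + \<tau> *\<^sub>R v t)" y z u
    by unfold_locales
  obtain C s0 where "card T = 3" "\<forall>p. p + (\<Sum>i\<in>T. (C i \<bullet> p) *\<^sub>R v i) = 0"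
    "\<forall>i\<in>T. \<forall>j\<in>T. C i \<bullet> v j = (if i = j then -1 else 0)" "s0 \<in> S" "\<forall>i\<in>T. C i \<bullet> v s0 > 0"
    by (rule exists_frame)
  then interpret framed_collision I v x t \<sigma> "\<lambda>\<tau>. v(x := v x + \<tau> *\<^sub>R v t)" y z u C s0
    by unfold_locales blast+
  show False by (rule contradiction)
qed

subsection \<open>Tverberg partitions\<close>

text \<open>If the removal of a smallest surrounding \<open>J\<close> costs more than 3, some closed
  half-space contains all of \<open>J\<close>, and \<open>J\<close> has four indices. Then the part
  of \<open>J\<close> in the boundary plane already surrounds the origin, and three indices suffice
  there, against minimality.\<close>

lemma deep_remove_simplex:
  fixes v :: "'i \<Rightarrow> real^3"
  assumes "finite I" "deep k I v" "k > 0"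
  obtains J where "J \<subseteq> I" "surrounds v J" "deep (k - 3) (I - J) v"
proof -
  have "surrounds v I" using deepD[OF assms(2), of "{}"] assms(3) by simp
  then obtain J where J: "J \<subseteq> I" "surrounds v J"
    and min: "\<And>K. K \<subseteq> I \<Longrightarrow> surrounds v K \<Longrightarrow> card J \<le> card K"
    using ex_has_least_nat[of "\<lambda>J. J \<subseteq> I \<and> surrounds v J" I card] by blast
  have fJ: "finite J" using J assms finite_subset by blast
  obtain J' where "J' \<subseteq> J" "card J' \<le> DIM(real^3) + 1" "surrounds v J'"
    using surrounds_caratheodory[OF J(2)] .
  then have c4: "card J \<le> 4" using min[of J'] J(1) by force
  have "surrounds v (I - J - K)" if K: "K \<subseteq> I - J" "card K < k - 3" for K
  proof (rule ccontr)
    assume "\<not> ?thesis"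
    then obtain u where u: "\<And>i. i \<in> I - J - K \<Longrightarrow> u \<bullet> v i > 0"
      by (rule not_surroundsE) (use assms in auto)
    define L where "L = {i \<in> J. u \<bullet> v i \<le> 0}"
    have fK: "finite K" using K assms(1) finite_subset by auto
    have LJ: "L \<subseteq> J" by (auto simp: L_def)
    have "card L \<ge> 4"
    proof (rule ccontr)
      assume "\<not> card L \<ge> 4"
      then have "card (K \<union> L) < k" using card_Un_le[of K L] K(2) by linarith
      then have "surrounds v (I - (K \<union> L))"
        by (rule deepD[OF assms(2)]) (use K LJ J in auto)
      then obtain i where "i \<in> I - (K \<union> L)" "u \<bullet> v i \<le> 0"
        by (rule surrounds_inner) (use assms in auto)
      then show False using u[of i] by (cases "i \<in> J") (auto simp: L_def)
    qed
    then have L: "L = J" using card_seteq[OF fJ LJ] c4 by simp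
    \<comment> \<open>For \<open>u = 0\<close> there is no boundary plane. In that case nothing lies
      outside \<open>J\<close> and \<open>K\<close>, and deleting \<open>K\<close> with all but one
      index of \<open>J\<close> leaves a single surrounding index.\<close>
    have u0: "u \<noteq> 0"
    proof
      assume "u = 0"
      then have sub: "I - J \<subseteq> K" using u by fastforce
      obtain j where j: "j \<in> J" using L \<open>card L \<ge> 4\<close> by fastforce
      have "card (K \<union> (J - {j})) < k"
        using card_Un_le[of K "J - {j}"] K(2) c4 j fJ by simp
      then have "surrounds v (I - (K \<union> (J - {j})))"
        by (rule deepD[OF assms(2)]) (use K J in auto)
      then have "surrounds v {j}" by (rule surrounds_mono) (use sub in auto)
      then show False using min[of "{j}"] j J(1) L \<open>card L \<ge> 4\<close> by auto
    qed
    have "surrounds v {i \<in> J. (- u) \<bullet> v i = 0}"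
      using J(2) fJ by (rule surrounds_face) (use L in \<open>auto simp: L_def\<close>)
    then obtain M where M: "M \<subseteq> {i \<in> J. (- u) \<bullet> v i = 0}" "card M \<le> DIM(real^3)" "surrounds v M"
      by (rule surrounds_caratheodory_plane[where u = u]) (use u0 in auto)
    then have "card J \<le> 3" using min[of M] J(1) by force
    then show False using \<open>card L \<ge> 4\<close> L by simp
  qed
  then show ?thesis using that[of J] J by (simp add: deep_def)
qed

text \<open>\<open>r\<close> counts the removals, so \<open>r = m - 2\<close> in the application.
  The base case uses up all remaining indices, so the parts cover \<open>I\<close>.\<close>

lemma deep_partition:
  fixes v :: "'i \<Rightarrow> real^3"
  assumes "finite I" "deep (3 * r + 3) I v"
  obtains A where "\<And>i. i < r + 2 \<Longrightarrow> A i \<subseteq> I \<and> surrounds v (A i)" "disjoint_family_on A {..<r+2}" "(\<Union>i<r+2. A i) = I"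
  using assms
proof (induction r arbitrary: I thesis)
  case 0
  from 0(2) have "deep 3 I v" using 0(3) by simp
  with 0(2) obtain A where A: "A \<subseteq> I" "surrounds v A" "surrounds v (I - A)" by (rule deep3_split)
  show ?case
  proof (rule 0(1))
    let ?A = "\<lambda>i::nat. if i = 0 then A else I - A"
    show "?A i \<subseteq> I \<and> surrounds v (?A i)" for i using A by auto
    show "disjoint_family_on ?A {..<0 + 2}" by (auto simp: disjoint_family_on_def)
    show "(\<Union>i<0 + 2. ?A i) = I" using A(1) by (auto intro: exI[of _ "1::nat"] bexI[of _ "0::nat"] bexI[of _ "1::nat"])
  qed
next
  case (Suc r)
  have k: "3 * Suc r + 3 > 0" by simp
  obtain J where J: "J \<subseteq> I" "surrounds v J" "deep (3 * Suc r + 3 - 3) (I - J) v"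
    using deep_remove_simplex[OF Suc.prems(2,3) k] .
  then have "deep (3 * r + 3) (I - J) v" by (simp add: add.commute)
  then obtain A where A: "\<And>i. i < r + 2 \<Longrightarrow> A i \<subseteq> I - J \<and> surrounds v (A i)"
    "disjoint_family_on A {..<r+2}" "(\<Union>i<r+2. A i) = I - J"
    using Suc.IH[of "I - J"] Suc.prems(2) by blast
  show ?case
  proof (rule Suc.prems(1))
    let ?A = "A(r + 2 := J)"
    show "?A i \<subseteq> I \<and> surrounds v (?A i)" if "i < Suc r + 2" for i
      using A(1)[of i] J that by (cases "i = r + 2") auto
    have dJ: "A i \<inter> J = {}" if "i < r + 2" for i using A(1)[OF that] by blast
    show "disjoint_family_on ?A {..<Suc r + 2}"
      unfolding disjoint_family_on_def
    proof (intro ballI impI)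
      fix a b assume ab: "a \<in> {..<Suc r + 2}" "b \<in> {..<Suc r + 2}" "a \<noteq> b"
      then consider "a = r + 2" "b < r + 2" | "b = r + 2" "a < r + 2" | "a < r + 2" "b < r + 2"
        by fastforce
      then show "?A a \<inter> ?A b = {}"
      proof cases
        case 3
        then show ?thesis using disjoint_family_onD[OF A(2), of a b] ab(3) by simp
      qed (use dJ[of a] dJ[of b] in auto)
    qed
    have "(\<Union>i<Suc r + 2. ?A i) = J \<union> (\<Union>i<r + 2. A i)"
      by (auto simp: less_Suc_eq split: if_splits)
    then show "(\<Union>i<Suc r + 2. ?A i) = I" using A(3) J(1) by auto
  qed
qed

lemma convex_hull_translate_zero:
  "0 \<in> convex hull ((\<lambda>x. x - c) ` S) \<longleftrightarrow> c \<in> convex hull S"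
proof -
  have "(\<lambda>x. x - c) ` S = (+) (-c) ` S" by auto
  then have "convex hull ((\<lambda>x. x - c) ` S) = (+) (-c) ` (convex hull S)"
    by (simp only: convex_hull_translation)
  then show ?thesis by (auto simp: image_iff)
qed

lemma sum_image_mset_disjoint:
  fixes A :: "nat \<Rightarrow> 'i set"
  assumes "disjoint_family_on A {..<m}" "\<And>i. i < m \<Longrightarrow> finite (A i)"
  shows "(\<Sum>i<m. image_mset f (mset_set (A i))) = image_mset f (mset_set (\<Union>i<m. A i))"
  using assms
proof (induction m)
  case (Suc m)
  have "A i \<inter> A m = {}" if "i < m" for i
    using disjoint_family_onD[OF Suc.prems(1), of i m] that by simp
  then have "(\<Union>i<m. A i) \<inter> A m = {}" by blast
  then have "mset_set ((\<Union>i<m. A i) \<union> A m) = mset_set (\<Union>i<m. A i) + mset_set (A m)"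
    using Suc.prems(2) by (intro mset_set_Union) auto
  moreover have "disjoint_family_on A {..<m}"
    using Suc.prems(1) by (rule disjoint_family_on_mono[rotated]) auto
  then have "(\<Sum>i<m. image_mset f (mset_set (A i))) = image_mset f (mset_set (\<Union>i<m. A i))"
    by (rule Suc.IH) (use Suc.prems(2) in auto)
  ultimately show ?case
    by (simp add: lessThan_Suc Un_commute add.commute)
qed simp

lemma tverberg_int_lattice3:
  assumes "m \<ge> 2"
  shows "tverberg_property int_lattice3 m (24 * m - 31)"
  unfolding tverberg_property_def
proof (intro allI impI, elim conjE)
  fix X :: "(real^3) multiset"
  assume X: "set_mset X \<subseteq> int_lattice3" "size X = 24 * m - 31"
  \<comment> \<open>Positions in a list label the points, so that equal points count
    separately.\<close>
  obtain xs where xs: "X = mset xs" using ex_mset by metis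
  define I where "I = {..<length xs}"
  have fI: "finite I" by (simp add: I_def)
  \<comment> \<open>24m - 31 is the first size beyond 8(3m - 4).\<close>
  have "card I > 8 * (3 * m - 4)" using X(2) xs assms by (simp add: I_def)
  moreover have "(!) xs ` I \<subseteq> int_lattice3" using X(1) xs by (auto simp: I_def)
  ultimately obtain c where c: "c \<in> int_lattice3"
    "\<And>J. J \<subseteq> I \<Longrightarrow> card J \<le> 3 * m - 4 \<Longrightarrow> surrounds (\<lambda>i. xs ! i - c) (I - J)"
    using lattice_centerpoint[OF fI, of "(!) xs" "3 * m - 4"] by blast
  \<comment> \<open>At most 3m - 4 deletions means fewer than 3m - 3 = 3(m - 2) + 3.\<close>
  have "deep (3 * (m - 2) + 3) I (\<lambda>i. xs ! i - c)"
    unfolding deep_def using c(2) assms by auto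
  then obtain A where A: "\<And>i. i < m - 2 + 2 \<Longrightarrow> A i \<subseteq> I \<and> surrounds (\<lambda>i. xs ! i - c) (A i)"
    "disjoint_family_on A {..<m-2+2}" "(\<Union>i<m-2+2. A i) = I"
    by (rule deep_partition[OF fI]) blast
  have m: "m - 2 + 2 = m" using assms by simp
  note A = A[unfolded m]
  have fA: "finite (A i)" if "i < m" for i using A(1)[OF that] fI finite_subset by blast
  define B where "B i = image_mset ((!) xs) (mset_set (A i))" for i
  have "(\<Sum>i<m. B i) = image_mset ((!) xs) (mset_set I)"
    using sum_image_mset_disjoint[OF A(2) fA] A(3) by (simp add: B_def)
  also have "\<dots> = X"
    unfolding xs I_def mset_set_upto_eq_mset_upto mset_map[symmetric] map_nth ..
  finally have "(\<Sum>i<m. B i) = X" .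
  moreover have "c \<in> convex hull (set_mset (B i))" if "i < m" for i
  proof -
    have "(\<lambda>i. xs ! i - c) ` A i = (\<lambda>x. x - c) ` ((!) xs ` A i)" by (simp add: image_image)
    then show ?thesis
      using A(1)[OF that] fA[OF that] by (simp add: surrounds_def convex_hull_translate_zero B_def)
  qed
  ultimately show "tverberg_partitionable int_lattice3 m X"
    unfolding tverberg_partitionable_def using c(1) by blast
qed

theorem theorem2:
  fixes m :: nat
  assumes "m \<ge> 2"
  shows "Tv int_lattice3 m \<le> enat (24 * m - 31)"
proof -
  have "24 * m - 31 > 0" using assms by simp
  then have "24 * m - 31 > 0 \<and> tverberg_property int_lattice3 m (24 * m - 31)"
    using tverberg_int_lattice3[OF assms] by blast
  then show ?thesis
    unfolding Tv_def by (auto intro!: Least_le simp del: zero_less_diff)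
qed

end
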